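(* Suppose Assumptions 1 and 2 hold. Let $\bar\xi_0\in\Xi_0$, $\tau\in\mathcal T$, $W\in\mathbb Z_{\ge0}$ and $\bar w_{\tau-1}\in\mathbb R^{n_x}\times\mathbb R^{n_u}$. Then for every $\bar{\boldsymbol\xi}_{0:\tau}\in\boldsymbol\Xi_{0:\tau}(\bar\xi_0)$ the truncated problem $\mathrm{P}_{\tau,W}(\bar{\boldsymbol\xi}_{0:\tau},\bar w_{\tau-1})$ has a unique solution, so that $\{w^{(\tau,W)}_t(\cdot;\bar w_{\tau-1})\}_{t\in\mathcal T_{\tau:\tau+W}}$ is well defined. Moreover, for all $t\in\mathcal T_{\tau:\tau+W}$ and $\bar{\boldsymbol\xi}_{0:\tau}\in\boldsymbol\Xi_{0:\tau}(\bar\xi_0)$, $$\Big\{\mathbb E\big[\|w^{(\tau,W)}_t(\boldsymbol\xi_{0:t};\bar w_{\tau-1})\|^2\,\big|\,\boldsymbol\xi_{0:\tau}=\bar{\boldsymbol\xi}_{0:\tau}\big]\Big\}^{1/2}\le c_1\Big(2L\rho^{t-\tau}\|\bar w_{\tau-1}\|+\sum_{t'\in\mathcal T_{\tau:\tau+W}}\rho^{|t-t'|}\Big\{\mathbb E\big[\|p(\xi_{t'})\|^2\,\big|\,\boldsymbol\xi_{0:\tau}=\bar{\boldsymbol\xi}_{0:\tau}\big]\Big\}^{1/2}\Big).$$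
   Context: Setting. $T\in\mathbb Z_{>0}$, $\mathcal T=\{0,\dots,T\}$, $\mathcal T_{a:b}=\mathcal T\cap\{a,\dots,b\}$ (so $\mathcal T_{a:b}=\mathcal T_{a:T}$ if $b>T$). $\boldsymbol\xi=(\xi_0,\dots,\xi_T)$ is a stochastic process with values in a measurable set $\Xi$ with known distribution; $\boldsymbol\xi_{a:b}=(\xi_a,\dots,\xi_b)$. $\Xi_0$ is the support of $\xi_0$, $\boldsymbol\Xi_{0:t}$ the support of $\boldsymbol\xi_{0:t}$, and for $\tau\le t$, $\boldsymbol\Xi_{0:t}(\bar{\boldsymbol\xi}_{0:\tau})=\{\boldsymbol\zeta_{0:t}\in\boldsymbol\Xi_{0:t}:\boldsymbol\zeta_{0:\tau}=\bar{\boldsymbol\xi}_{0:\tau}\}$. Data: functions $A:\Xi\to\mathbb R^{n_x\times n_x}$, $B:\Xi\to\mathbb R^{n_x\times n_u}$, $d:\Xi\to\mathbb R^{n_x}$, $Q:\Xi\to\mathbb S_{n_x}$, $R:\Xi\to\mathbb S_{n_u}$ (symmetric matrices), $q:\Xi\to\mathbb R^{n_x}$, $r:\Xi\to\mathbb R^{n_u}$. For $w=[x;u]\in\mathbb R^{n_x}\times\mathbb R^{n_u}$: $f(w;\xi)=A(\xi)x+B(\xi)u+d(\xi)$, $\ell(w;\xi)=\tfrac12x^\top Q(\xi)x+\tfrac12u^\top R(\xi)u-q(\xi)^\top x-r(\xi)^\top u$, and $p(\xi)=[q(\xi);r(\xi);d(\xi)]$. Truncated problem $\mathrm P_{\tau,W}(\bar{\boldsymbol\xi}_{0:\tau},\bar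 w_{\tau-1})$: minimize $\mathbb E[\sum_{t\in\mathcal T_{\tau:\tau+W}}\ell(w_t(\boldsymbol\xi_{0:t});\xi_t)\mid\boldsymbol\xi_{0:\tau}=\bar{\boldsymbol\xi}_{0:\tau}]$ over functions $w_t=[x_t;u_t]:\boldsymbol\Xi_{0:t}(\bar{\boldsymbol\xi}_{0:\tau})\to\mathbb R^{n_x}\times\mathbb R^{n_u}$, $t\in\mathcal T_{\tau:\tau+W}$, subject to $x_\tau(\bar{\boldsymbol\xi}_{0:\tau})=f(\bar w_{\tau-1};\bar\xi_\tau)$ and $x_t(\boldsymbol\zeta_{0:t})=f(w_{t-1}(\boldsymbol\zeta_{0:t-1});\zeta_t)$ for all $t\in\mathcal T_{\tau+1:\tau+W}$, $\boldsymbol\zeta_{0:t}\in\boldsymbol\Xi_{0:t}(\bar{\boldsymbol\xi}_{0:\tau})$. Since the sets $\boldsymbol\Xi_{0:t}(\bar{\boldsymbol\xi}_{0:\tau})$ for distinct $\bar{\boldsymbol\xi}_{0:\tau}\in\boldsymbol\Xi_{0:\tau}(\bar\xi_0)$ are disjoint, the solutions for all such $\bar{\boldsymbol\xi}_{0:\tau}$ are glued into maps $w^{(\tau,W)}_t(\cdot;\bar w_{\tau-1}):\boldsymbol\Xi_{0:t}(\bar\xi_0)\to\mathbb R^{n_x}\times\mathbb R^{n_u}$. Assumption 1: $\boldsymbol\xi$ has finite support. Stochastic stability notions: $\{\Phi_t(\boldsymbol\xi_{0:t})\}_{t\in\mathcal T_{1:T}}$ is $(L,\alpha)$-stable if $\|\Phi_{t''}(\boldsymbol\xi_{0:t''})\cdots\Phi_{t'+1}(\boldsymbol\xi_{0:t'+1})\|\le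 L\alpha^{t''-t'}$ a.s. for all $t'<t''$ in $\mathcal T$; $(\{A(\xi_t)\}_{t\in\mathcal T_{1:T}},\{B(\xi_t)\}_{t\in\mathcal T_{1:T}})$ is $(L,\alpha)$-stabilizable if there are $K_t(\boldsymbol\xi_{0:t})$, $t\in\mathcal T_{0:T-1}$ (functions of $\boldsymbol\xi_{0:t}$ only) with $\|K_t\|\le L$ a.s. such that $\{A(\xi_t)-B(\xi_t)K_{t-1}(\boldsymbol\xi_{0:t-1})\}_{t\in\mathcal T_{1:T}}$ is $(L,\alpha)$-stable; $(\{A(\xi_t)\}_{t\in\mathcal T_{1:T}},\{C(\xi_t)\}_{t\in\mathcal T_{0:T-1}})$ is $(L,\alpha)$-detectable if there are $K_t(\boldsymbol\xi_{0:t})$, $t\in\mathcal T_{1:T}$, with $\|K_t\|\le L$ a.s. such that $\{A(\xi_t)-K_t(\boldsymbol\xi_{0:t})C(\xi_{t-1})\}_{t\in\mathcal T_{1:T}}$ is $(L,\alpha)$-stable. Assumption 2: there exist $L\ge1$, $\alpha\in(0,1)$, $\gamma\in(0,1]$ such that (a) $\|A(\xi_t)\|,\|B(\xi_t)\|,\|Q(\xi_t)\|,\|R(\xi_t)\|\le L$ a.s. for $t\in\mathcal T$; (b) $Q(\xi_t)\succeq0$ and $R(\xi_t)\succeq\gamma I$ a.s.; (c) $(\{A(\xi_t)\},\{B(\xi_t)\})$ is $(L,\alpha)$-stabilizable; (d) $(\{A(\xi_t)\}_{t\in\mathcal T_{1:T}},\{Q(\xi_t)^{1/2}\}_{t\in\mathcal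 T_{0:T-1}})$ is $(L,\alpha)$-detectable. Constants: $L_H=2L+1$, $\gamma_F=\frac{(1-\alpha)^2}{(1+L)^2L^2}$, $\gamma_G=\frac{\gamma(1-\alpha)^2}{2(1+L)^2L^4}$, $\bar\mu=\frac{2L_H^2/\gamma_G+\gamma_G+L_H}{\gamma_F}$, $\gamma_H=\Big(\frac2{\gamma_G}+\big(1+\frac{4L_H}{\gamma_G}+\frac{4L_H^2}{\gamma_G^2}\big)\frac{L_H(1+\bar\mu L_H)}{\gamma_F}+\bar\mu\Big)^{-1}$, $\rho=\big(\frac{L_H^2-\gamma_H^2}{L_H^2+\gamma_H^2}\big)^{1/2}$, $c_1=\frac{L_H}{\gamma_H^2\rho}$. *)

theory Defs
  imports "HOL-Probability.Probability"
begin

text \<open>Paths of the stochastic process are lists of length T+1 (entries xi_0..xi_T);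
  the distribution is a pmf on such lists. The prefix xi_{0:t} of a path z is take (Suc t) z.\<close>

definition spec_norm :: "real^'n^'m \<Rightarrow> real" where
  "spec_norm M = onorm (\<lambda>x. M *v x)"

definition psd :: "real^'n^'n \<Rightarrow> bool" where
  "psd M \<longleftrightarrow> transpose M = M \<and> (\<forall>x. 0 \<le> x \<bullet> (M *v x))"

definition msqrt :: "real^'n^'n \<Rightarrow> real^'n^'n" where
  "msqrt M = (THE S. psd S \<and> S ** S = M)"

fun mprod :: "(nat \<Rightarrow> real^'n^'n) \<Rightarrow> nat \<Rightarrow> nat \<Rightarrow> real^'n^'n" where
  "mprod Phi t' 0 = mat 1"
| "mprod Phi t' (Suc s) = (if Suc s \<le> t' then mat 1 else Phi (Suc s) ** mprod Phi t' s)"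

text \<open>Phi t applied to the prefix xi_{0:t}; stability almost surely = on every support path.\<close>
definition stoch_stable ::
  "'x list pmf \<Rightarrow> nat \<Rightarrow> real \<Rightarrow> real \<Rightarrow> (nat \<Rightarrow> 'x list \<Rightarrow> real^'n^'n) \<Rightarrow> bool" where
  "stoch_stable P T L \<alpha> Phi \<longleftrightarrow>
     (\<forall>z\<in>set_pmf P. \<forall>t' t''. t' < t'' \<and> t'' \<le> T \<longrightarrow>
        spec_norm (mprod (\<lambda>s. Phi s (take (Suc s) z)) t' t'') \<le> L * \<alpha> ^ (t'' - t'))"

definition stoch_stabilizable ::
  "'x list pmf \<Rightarrow> nat \<Rightarrow> real \<Rightarrow> real \<Rightarrow> ('x \<Rightarrow> real^'n^'n) \<Rightarrow> ('x \<Rightarrow> real^'m^'n) \<Rightarrow> bool" where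
  "stoch_stabilizable P T L \<alpha> A B \<longleftrightarrow>
     (\<exists>K :: nat \<Rightarrow> 'x list \<Rightarrow> real^'n^'m.
        (\<forall>z\<in>set_pmf P. \<forall>t<T. spec_norm (K t (take (Suc t) z)) \<le> L) \<and>
        stoch_stable P T L \<alpha> (\<lambda>t zs. A (zs ! t) - B (zs ! t) ** K (t - 1) (take t zs)))"

definition stoch_detectable ::
  "'x list pmf \<Rightarrow> nat \<Rightarrow> real \<Rightarrow> real \<Rightarrow> ('x \<Rightarrow> real^'n^'n) \<Rightarrow> ('x \<Rightarrow> real^'n^'k) \<Rightarrow> bool" where
  "stoch_detectable P T L \<alpha> A C \<longleftrightarrow>
     (\<exists>K :: nat \<Rightarrow> 'x list \<Rightarrow> real^'k^'n.
        (\<forall>z\<in>set_pmf P. \<forall>t. 1 \<le> t \<and> t \<le> T \<longrightarrow> spec_norm (K t (take (Suc t) z)) \<le> L) \<and>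
        stoch_stable P T L \<alpha> (\<lambda>t zs. A (zs ! t) - K t zs ** C (zs ! (t - 1))))"

definition dyn :: "('x \<Rightarrow> real^'nx^'nx) \<Rightarrow> ('x \<Rightarrow> real^'nu^'nx) \<Rightarrow> ('x \<Rightarrow> real^'nx)
    \<Rightarrow> (real^'nx) \<times> (real^'nu) \<Rightarrow> 'x \<Rightarrow> real^'nx" where
  "dyn A B d w \<xi> = A \<xi> *v fst w + B \<xi> *v snd w + d \<xi>"

definition stage_cost :: "('x \<Rightarrow> real^'nx^'nx) \<Rightarrow> ('x \<Rightarrow> real^'nu^'nu) \<Rightarrow> ('x \<Rightarrow> real^'nx)
    \<Rightarrow> ('x \<Rightarrow> real^'nu) \<Rightarrow> (real^'nx) \<times> (real^'nu) \<Rightarrow> 'x \<Rightarrow> real" where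
  "stage_cost Q R q r w \<xi> =
     (1/2) * (fst w \<bullet> (Q \<xi> *v fst w)) + (1/2) * (snd w \<bullet> (R \<xi> *v snd w))
     - q \<xi> \<bullet> fst w - r \<xi> \<bullet> snd w"

definition prefix_event :: "nat \<Rightarrow> 'x list \<Rightarrow> 'x list set" where
  "prefix_event \<tau> s = {z. take (Suc \<tau>) z = s}"

definition cond_exp :: "'x list pmf \<Rightarrow> nat \<Rightarrow> 'x list \<Rightarrow> ('x list \<Rightarrow> real) \<Rightarrow> real" where
  "cond_exp P \<tau> s g = measure_pmf.expectation (cond_pmf P (prefix_event \<tau> s)) g"

text \<open>Feasibility for the truncated problem P_{tau,W}(s, wbar): a policy w t maps prefixes
  of length t+1 to (x_t,u_t); only its values on prefixes extending s in the support matter.\<close>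
definition trunc_feasible ::
  "'x list pmf \<Rightarrow> nat \<Rightarrow> ('x \<Rightarrow> real^'nx^'nx) \<Rightarrow> ('x \<Rightarrow> real^'nu^'nx) \<Rightarrow> ('x \<Rightarrow> real^'nx)
   \<Rightarrow> nat \<Rightarrow> nat \<Rightarrow> 'x list \<Rightarrow> (real^'nx) \<times> (real^'nu)
   \<Rightarrow> (nat \<Rightarrow> 'x list \<Rightarrow> (real^'nx) \<times> (real^'nu)) \<Rightarrow> bool" where
  "trunc_feasible P T A B d \<tau> W s wbar w \<longleftrightarrow>
     fst (w \<tau> s) = dyn A B d wbar (s ! \<tau>) \<and>
     (\<forall>z\<in>set_pmf P \<inter> prefix_event \<tau> s. \<forall>t. \<tau> < t \<and> t \<le> min (\<tau> + W) T \<longrightarrow>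
        fst (w t (take (Suc t) z)) = dyn A B d (w (t - 1) (take t z)) (z ! t))"

definition trunc_cost ::
  "'x list pmf \<Rightarrow> nat \<Rightarrow> ('x \<Rightarrow> real^'nx^'nx) \<Rightarrow> ('x \<Rightarrow> real^'nu^'nu) \<Rightarrow> ('x \<Rightarrow> real^'nx)
   \<Rightarrow> ('x \<Rightarrow> real^'nu) \<Rightarrow> nat \<Rightarrow> nat \<Rightarrow> 'x list
   \<Rightarrow> (nat \<Rightarrow> 'x list \<Rightarrow> (real^'nx) \<times> (real^'nu)) \<Rightarrow> real" where
  "trunc_cost P T Q R q r \<tau> W s w =
     cond_exp P \<tau> s (\<lambda>z. \<Sum>t\<in>{\<tau>..min (\<tau> + W) T}. stage_cost Q R q r (w t (take (Suc t) z)) (z ! t))"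

definition trunc_solution ::
  "'x list pmf \<Rightarrow> nat \<Rightarrow> ('x \<Rightarrow> real^'nx^'nx) \<Rightarrow> ('x \<Rightarrow> real^'nu^'nx) \<Rightarrow> ('x \<Rightarrow> real^'nx)
   \<Rightarrow> ('x \<Rightarrow> real^'nx^'nx) \<Rightarrow> ('x \<Rightarrow> real^'nu^'nu) \<Rightarrow> ('x \<Rightarrow> real^'nx) \<Rightarrow> ('x \<Rightarrow> real^'nu)
   \<Rightarrow> nat \<Rightarrow> nat \<Rightarrow> 'x list \<Rightarrow> (real^'nx) \<times> (real^'nu)
   \<Rightarrow> (nat \<Rightarrow> 'x list \<Rightarrow> (real^'nx) \<times> (real^'nu)) \<Rightarrow> bool" where
  "trunc_solution P T A B d Q R q r \<tau> W s wbar w \<longleftrightarrow>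
     trunc_feasible P T A B d \<tau> W s wbar w \<and>
     (\<forall>w'. trunc_feasible P T A B d \<tau> W s wbar w' \<longrightarrow>
        trunc_cost P T Q R q r \<tau> W s w \<le> trunc_cost P T Q R q r \<tau> W s w')"

definition policies_agree ::
  "'x list pmf \<Rightarrow> nat \<Rightarrow> nat \<Rightarrow> nat \<Rightarrow> 'x list
   \<Rightarrow> (nat \<Rightarrow> 'x list \<Rightarrow> 'b) \<Rightarrow> (nat \<Rightarrow> 'x list \<Rightarrow> 'b) \<Rightarrow> bool" where
  "policies_agree P T \<tau> W s w w' \<longleftrightarrow>
     (\<forall>z\<in>set_pmf P \<inter> prefix_event \<tau> s. \<forall>t\<in>{\<tau>..min (\<tau> + W) T}.
        w t (take (Suc t) z) = w' t (take (Suc t) z))"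

definition L_H :: "real \<Rightarrow> real" where "L_H L = 2 * L + 1"
definition gamma_F :: "real \<Rightarrow> real \<Rightarrow> real" where
  "gamma_F L \<alpha> = (1 - \<alpha>)^2 / ((1 + L)^2 * L^2)"
definition gamma_G :: "real \<Rightarrow> real \<Rightarrow> real \<Rightarrow> real" where
  "gamma_G L \<alpha> \<gamma> = \<gamma> * (1 - \<alpha>)^2 / (2 * (1 + L)^2 * L^4)"
definition mu_bar :: "real \<Rightarrow> real \<Rightarrow> real \<Rightarrow> real" where
  "mu_bar L \<alpha> \<gamma> = (2 * (L_H L)^2 / gamma_G L \<alpha> \<gamma> + gamma_G L \<alpha> \<gamma> + L_H L) / gamma_F L \<alpha>"
definition gamma_H :: "real \<Rightarrow> real \<Rightarrow> real \<Rightarrow> real" where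
  "gamma_H L \<alpha> \<gamma> = inverse (2 / gamma_G L \<alpha> \<gamma>
     + (1 + 4 * L_H L / gamma_G L \<alpha> \<gamma> + 4 * (L_H L)^2 / (gamma_G L \<alpha> \<gamma>)^2)
        * (L_H L * (1 + mu_bar L \<alpha> \<gamma> * L_H L) / gamma_F L \<alpha>)
     + mu_bar L \<alpha> \<gamma>)"
definition rho_c :: "real \<Rightarrow> real \<Rightarrow> real \<Rightarrow> real" where
  "rho_c L \<alpha> \<gamma> = sqrt (((L_H L)^2 - (gamma_H L \<alpha> \<gamma>)^2) / ((L_H L)^2 + (gamma_H L \<alpha> \<gamma>)^2))"
definition c_1 :: "real \<Rightarrow> real \<Rightarrow> real \<Rightarrow> real" where
  "c_1 L \<alpha> \<gamma> = L_H L / ((gamma_H L \<alpha> \<gamma>)^2 * rho_c L \<alpha> \<gamma>)"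

end

theory Submission
  imports Defs
begin

text \<open>The truncated problem is a convex quadratic program on the space of functions on the nodes
  (prefixes) of a finite scenario tree, with inner product weighted by the conditional
  probabilities. Its KKT operator \<open>H = [G, F\<^sup>*; F, 0]\<close> is self-adjoint and couples only adjacent
  stages. Moreover \<open>\<sigma> \<parallel>v\<parallel> \<le> \<parallel>H v\<parallel> \<le> L_H \<parallel>v\<parallel>\<close> with \<open>\<sigma> = gamma_H\<close>: stabilizability gives a
  bounded right inverse of the constraint operator \<open>F\<close> (feedback control), and detectability gives
  coercivity of the cost \<open>G\<close> on the kernel of \<open>F\<close>. Hence \<open>M = I - \<eta> H\<^sup>2\<close> with
  \<open>\<eta> = 2 / (L_H\<^sup>2 + \<sigma>\<^sup>2)\<close> has norm at most \<open>\<rho>\<^sup>2\<close>, and in the Neumann series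
  \<open>\<Sum>k. \<eta> M\<^sup>k H b\<close> for the solution of \<open>H v = b\<close> a datum at stage \<open>t'\<close> reaches stage \<open>t\<close> only
  from the terms with \<open>2 k + 1 \<ge> \<bar>t - t'\<bar>\<close>. The primal part of the KKT solution is the unique
  minimizer because \<open>G\<close> is coercive on the kernel of \<open>F\<close>.\<close>

section \<open>Banded self-adjoint operators on weighted l2 spaces\<close>

text \<open>\<open>H\<close> is indefinite, so no damped iteration with \<open>H\<close> itself
  contracts; its square is positive, with form between \<sigma>^2 and L_H^2, and \<eta> balances the
  two ends. Squaring costs a spread of two stages per contraction by
  \<open>\<theta> = \<rho>^2\<close>, hence the rate \<rho> per stage. The rounding for odd
  distances costs the factor \<open>1 / \<rho>\<close> in \<open>c_1\<close>; the rest of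
  \<open>c_1\<close> is \<open>L_H * \<eta> / (1 - \<theta>) = L_H / gamma_H^2\<close>. The lower
  bound for \<open>H\<close> is a saddle-point estimate in terms of \<open>gamma_G\<close> and of
  the norm bound \<open>gamma_F^(-1/2)\<close> for the feedback policy; the formula for
  \<open>gamma_H\<close> is then compared with that estimate. The series itself produces the KKT
  point, so existence needs no dimension count. Policies are functions on all lists, but only their
  values at prefixes of the relevant paths matter. All norms are therefore seminorms, and equations
  are asserted at nodes only.\<close>

locale weighted_l2 =
  fixes J :: "'j set" and nu :: "'j \<Rightarrow> 'i" and m :: "'j \<Rightarrow> real"
  assumes finite_J: "finite J" and m_pos: "j \<in> J \<Longrightarrow> 0 < m j"
begin

text \<open>\<open>nu\<close> need not be injective: later \<open>J\<close> consists of pairs of a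
  path and a stage, and all paths through a prefix are sent to it, so a prefix is weighted by its
  total probability. Values off the range of \<open>nu\<close> on \<open>J\<close> do not count, so
  \<open>nrm\<close> is only a seminorm.\<close>

definition ip :: "('i \<Rightarrow> 'e::real_inner) \<Rightarrow> ('i \<Rightarrow> 'e) \<Rightarrow> real" where
  "ip f g = (\<Sum>j\<in>J. m j * (f (nu j) \<bullet> g (nu j)))"

definition nrm :: "('i \<Rightarrow> 'e::real_inner) \<Rightarrow> real" where
  "nrm f = sqrt (ip f f)"

section \<open>Algebra of the weighted inner product and its seminorm\<close>

lemma ip_commute: "ip f g = ip g f"
  by (simp add: ip_def inner_commute)

lemma ip_add_left: "ip (\<lambda>i. f i + g i) h = ip f h + ip g h"
  by (simp add: ip_def inner_add_left distrib_left sum.distrib)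

lemma ip_diff_left: "ip (\<lambda>i. f i - g i) h = ip f h - ip g h"
  by (simp add: ip_def inner_diff_left right_diff_distrib sum_subtractf)

lemma ip_scale_left: "ip (\<lambda>i. c *\<^sub>R f i) h = c * ip f h"
  by (simp add: ip_def sum_distrib_left mult.left_commute)

lemma ip_add_right: "ip h (\<lambda>i. f i + g i) = ip h f + ip h g"
  by (simp add: ip_commute[of h] ip_add_left)

lemma ip_diff_right: "ip h (\<lambda>i. f i - g i) = ip h f - ip h g"
  by (simp add: ip_commute[of h] ip_diff_left)

lemma ip_scale_right: "ip h (\<lambda>i. c *\<^sub>R f i) = c * ip h f"
  by (simp add: ip_commute[of h] ip_scale_left)

lemmas ip_simps = ip_add_left ip_diff_left ip_scale_left ip_add_right ip_diff_right ip_scale_right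

lemma ip_cong:
  assumes "\<And>j. j \<in> J \<Longrightarrow> f (nu j) = f' (nu j)" "\<And>j. j \<in> J \<Longrightarrow> g (nu j) = g' (nu j)"
  shows "ip f g = ip f' g'"
  using assms by (auto simp: ip_def)

lemma nrm_cong:
  assumes "\<And>j. j \<in> J \<Longrightarrow> f (nu j) = f' (nu j)"
  shows "nrm f = nrm f'"
  using ip_cong[of f f' f f'] assms by (simp add: nrm_def)

lemma ip_ge_0: "0 \<le> ip f f"
  unfolding ip_def by (intro sum_nonneg mult_nonneg_nonneg) (auto intro: less_imp_le[OF m_pos])

lemma nrm_ge_0 [simp]: "0 \<le> nrm f"
  by (simp add: nrm_def ip_ge_0)

lemma nrm_power2: "(nrm f)\<^sup>2 = ip f f"
  by (simp add: nrm_def ip_ge_0)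

lemma nrm_L2_set: "nrm f = L2_set (\<lambda>j. sqrt (m j) * norm (f (nu j))) J"
  unfolding nrm_def L2_set_def ip_def
  by (intro arg_cong[where f = sqrt] sum.cong refl)
     (auto simp: power_mult_distrib less_imp_le[OF m_pos] power2_norm_eq_inner)

lemma nrm_mono:
  assumes "\<And>j. j \<in> J \<Longrightarrow> norm (f (nu j)) \<le> norm (g (nu j))"
  shows "nrm f \<le> nrm g"
  unfolding nrm_L2_set
  by (intro L2_set_mono mult_left_mono) (use assms m_pos in \<open>auto simp: less_imp_le\<close>)

lemma nrm_triangle: "nrm (\<lambda>i. f i + g i) \<le> nrm f + nrm g"
proof -
  have "nrm (\<lambda>i. f i + g i)
      \<le> L2_set (\<lambda>j. sqrt (m j) * norm (f (nu j)) + sqrt (m j) * norm (g (nu j))) J"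
    unfolding nrm_L2_set distrib_left[symmetric]
    by (intro L2_set_mono mult_left_mono norm_triangle_ineq)
       (auto simp: less_imp_le[OF m_pos])
  also have "\<dots> \<le> nrm f + nrm g"
    unfolding nrm_L2_set by (rule L2_set_triangle_ineq)
  finally show ?thesis .
qed

lemma nrm_scale: "nrm (\<lambda>i. c *\<^sub>R f i) = \<bar>c\<bar> * nrm f"
proof -
  have "ip (\<lambda>i. c *\<^sub>R f i) (\<lambda>i. c *\<^sub>R f i) = c\<^sup>2 * ip f f"
    by (simp add: ip_simps power2_eq_square)
  then show ?thesis
    by (simp add: nrm_def real_sqrt_mult)
qed

lemma nrm_zero [simp]: "nrm (\<lambda>i. 0) = 0"
  by (simp add: nrm_def ip_def)

lemma nrm_diff_le: "nrm (\<lambda>i. f i - g i) \<le> nrm f + nrm g"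
  using nrm_triangle[of f "\<lambda>i. (-1) *\<^sub>R g i"] nrm_scale[of "-1" g] by simp

lemma norm_le_nrm: "j \<in> J \<Longrightarrow> norm (f (nu j)) \<le> nrm f / sqrt (m j)"
  using member_le_L2_set[OF finite_J, of j "\<lambda>j. sqrt (m j) * norm (f (nu j))"] m_pos[of j]
  by (simp add: nrm_L2_set field_simps)

lemma nrm_eq_0_iff: "nrm f = 0 \<longleftrightarrow> (\<forall>j\<in>J. f (nu j) = 0)"
proof
  assume "nrm f = 0"
  then show "\<forall>j\<in>J. f (nu j) = 0"
    using norm_le_nrm[of _ f] by simp
next
  assume "\<forall>j\<in>J. f (nu j) = 0"
  then show "nrm f = 0"
    by (simp add: nrm_def ip_def)
qed

lemma ip_le_nrm_mult: "\<bar>ip f g\<bar> \<le> nrm f * nrm g"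
proof -
  have "\<bar>ip f g\<bar> \<le> (\<Sum>j\<in>J. \<bar>sqrt (m j) * norm (f (nu j))\<bar> * \<bar>sqrt (m j) * norm (g (nu j))\<bar>)"
    unfolding ip_def
  proof (rule order_trans[OF sum_abs], rule sum_mono)
    fix j assume j: "j \<in> J"
    have "\<bar>m j * (f (nu j) \<bullet> g (nu j))\<bar> \<le> m j * (norm (f (nu j)) * norm (g (nu j)))"
      using m_pos[OF j] Cauchy_Schwarz_ineq2[of "f (nu j)" "g (nu j)"] by (simp add: abs_mult)
    also have "\<dots> = (sqrt (m j))\<^sup>2 * (norm (f (nu j)) * norm (g (nu j)))"
      using m_pos[OF j] by simp
    also have "\<dots> = \<bar>sqrt (m j) * norm (f (nu j))\<bar> * \<bar>sqrt (m j) * norm (g (nu j))\<bar>"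
      using m_pos[OF j] by (simp add: power2_eq_square abs_mult)
    finally show "\<bar>m j * (f (nu j) \<bullet> g (nu j))\<bar> \<le> \<dots>" .
  qed
  also have "\<dots> \<le> nrm f * nrm g"
    unfolding nrm_L2_set by (rule L2_set_mult_ineq)
  finally show ?thesis .
qed

lemma nrm_tendsto_0:
  fixes f :: "nat \<Rightarrow> 'i \<Rightarrow> 'b::real_inner"
  assumes "\<And>j. j \<in> J \<Longrightarrow> (\<lambda>k. f k (nu j)) \<longlonglongrightarrow> 0"
  shows "(\<lambda>k. nrm (f k)) \<longlonglongrightarrow> 0"
proof -
  have "(\<lambda>k. nrm (f k)) \<longlonglongrightarrow> sqrt (\<Sum>j\<in>J. m j * (0 \<bullet> (0::'b)))"
    unfolding nrm_def ip_def by (intro tendsto_intros assms)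
  then show ?thesis by simp
qed

text \<open>The identities hold at every point, including those that \<open>nrm\<close> ignores, so
  they can be rewritten under further operators and inside iterates.\<close>

definition pointwise_linear :: "(('i \<Rightarrow> 'e::real_vector) \<Rightarrow> ('i \<Rightarrow> 'f::real_vector)) \<Rightarrow> bool" where
  "pointwise_linear M \<longleftrightarrow> (\<forall>f g. M (\<lambda>i. f i + g i) = (\<lambda>i. M f i + M g i))
     \<and> (\<forall>c f. M (\<lambda>i. c *\<^sub>R f i) = (\<lambda>i. c *\<^sub>R M f i))"

context
  fixes M :: "('i \<Rightarrow> 'e::real_vector) \<Rightarrow> ('i \<Rightarrow> 'f::real_vector)"
  assumes lin: "pointwise_linear M"
begin

lemma pointwise_linear_add: "M (\<lambda>i. f i + g i) = (\<lambda>i. M f i + M g i)"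
  using lin by (simp add: pointwise_linear_def)

lemma pointwise_linear_scale: "M (\<lambda>i. c *\<^sub>R f i) = (\<lambda>i. c *\<^sub>R M f i)"
  using lin by (simp add: pointwise_linear_def)

lemma pointwise_linear_zero: "M (\<lambda>i. 0) = (\<lambda>i. 0)"
  using pointwise_linear_scale[of 0 "\<lambda>i. 0"] by simp

lemma pointwise_linear_diff: "M (\<lambda>i. f i - g i) = (\<lambda>i. M f i - M g i)"
  using pointwise_linear_add[of f "\<lambda>i. (-1) *\<^sub>R g i"] pointwise_linear_scale[of "-1" g] by simp

lemma pointwise_linear_sum: "M (\<lambda>i. \<Sum>k\<in>K. f k i) = (\<lambda>i. \<Sum>k\<in>K. M (f k) i)"
  by (induction K rule: infinite_finite_induct)
     (simp_all add: pointwise_linear_zero pointwise_linear_add)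

end

text \<open>Polarisation bounds \<^term>\<open>ip (M f) g\<close> by \<open>c (ip f f + ip g g) / 2\<close>; then \<open>g = M f / c\<close>.\<close>

lemma selfadjoint_nrm_le:
  fixes M :: "('i \<Rightarrow> 'e::real_inner) \<Rightarrow> ('i \<Rightarrow> 'e)"
  assumes lin: "pointwise_linear M" and sa: "\<And>f g. ip (M f) g = ip f (M g)"
    and c: "0 < c" and bnd: "\<And>f. \<bar>ip f (M f)\<bar> \<le> c * ip f f"
  shows "nrm (M f) \<le> c * nrm f"
proof -
  define g where "g = (\<lambda>i. (1 / c) *\<^sub>R M f i)"
  have 1: "4 * ip (M f) g = ip (\<lambda>i. f i + g i) (M (\<lambda>i. f i + g i))
      - ip (\<lambda>i. f i - g i) (M (\<lambda>i. f i - g i))"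
    by (simp add: pointwise_linear_add[OF lin] pointwise_linear_diff[OF lin] ip_simps
        sa[symmetric] ip_commute[of g "M f"] ip_commute[of g "M g"] ip_commute[of f "M f"])
       (metis ip_commute sa)
  have "4 * ip (M f) g \<le> c * ip (\<lambda>i. f i + g i) (\<lambda>i. f i + g i)
      + c * ip (\<lambda>i. f i - g i) (\<lambda>i. f i - g i)"
    unfolding 1 using bnd[of "\<lambda>i. f i + g i"] bnd[of "\<lambda>i. f i - g i"] by linarith
  also have "\<dots> = 2 * c * (ip f f + ip g g)"
    by (simp add: ip_simps ip_commute[of g f] algebra_simps)
  finally have "4 * ((nrm (M f))\<^sup>2 / c) \<le> 2 * c * ((nrm f)\<^sup>2 + (nrm (M f))\<^sup>2 / c\<^sup>2)"
    by (simp add: g_def ip_simps nrm_power2 power2_eq_square[of c])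
  then have "(nrm (M f))\<^sup>2 \<le> (c * nrm f)\<^sup>2"
    using c by (simp add: field_simps power2_eq_square)
  then show ?thesis
    by (rule power2_le_imp_le) (use c in simp)
qed

end

text \<open>Used with \<open>a = \<Lambda>^2\<close> and \<open>b = \<sigma>^2\<close>. The step
  \<open>2 / (a + b)\<close> gives \<open>1 - step * x\<close> opposite values at the ends of
  \<open>[b, a]\<close>, which makes its largest modulus there as small as possible.\<close>

lemma ratio_bounds:
  fixes a b :: real
  assumes "0 < b" "b < a"
  shows "0 < (a - b) / (a + b)" "(a - b) / (a + b) < 1" "0 < 2 / (a + b)"
    "1 - 2 / (a + b) * a = - ((a - b) / (a + b))" "1 - 2 / (a + b) * b = (a - b) / (a + b)"
    "2 / (a + b) / (1 - (a - b) / (a + b)) = 1 / b"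
proof -
  have p: "0 < a + b" using assms by linarith
  then show "0 < (a - b) / (a + b)" "(a - b) / (a + b) < 1" "0 < 2 / (a + b)"
    "1 - 2 / (a + b) * a = - ((a - b) / (a + b))"
    and e: "1 - 2 / (a + b) * b = (a - b) / (a + b)"
    using assms by (auto simp: field_simps)
  have "1 - (a - b) / (a + b) = 2 / (a + b) * b" using e by simp
  moreover have "x / (x * b) = 1 / b" if "0 < x" for x :: real
    using that by simp
  ultimately show "2 / (a + b) / (1 - (a - b) / (a + b)) = 1 / b"
    using \<open>0 < 2 / (a + b)\<close> by metis
qed

text \<open>\<open>H\<close> may be indefinite, so the lower bound concerns the norm of the image,
  while a bound on the form is enough from above. In \<open>banded\<close>, \<open>S\<close> is a
  set of levels on which the data vanish; at level 0 the truncated \<open>lev i - 1\<close> merely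
  repeats the level itself.\<close>

locale banded_selfadjoint = weighted_l2 J nu m
  for J :: "'j set" and nu :: "'j \<Rightarrow> 'i" and m :: "'j \<Rightarrow> real" +
  fixes H :: "('i \<Rightarrow> 'e::{real_inner,banach}) \<Rightarrow> ('i \<Rightarrow> 'e)" and lev :: "'i \<Rightarrow> nat"
    and \<Lambda> \<sigma> :: real
  assumes linH: "pointwise_linear H"
    and selfadjoint: "ip (H f) g = ip f (H g)"
    and \<sigma>_pos: "0 < \<sigma>" and \<sigma>_less: "\<sigma> < \<Lambda>"
    and upper: "\<bar>ip f (H f)\<bar> \<le> \<Lambda> * ip f f"
    and lower: "\<sigma> * nrm f \<le> nrm (H f)"
    and banded: "\<lbrakk>\<And>i. lev i \<in> S \<Longrightarrow> f i = 0; {lev i - 1, lev i, lev i + 1} \<subseteq> S\<rbrakk> \<Longrightarrow> H f i = 0"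
begin

lemma nrm_H_le: "nrm (H f) \<le> \<Lambda> * nrm f"
  by (rule selfadjoint_nrm_le[OF linH selfadjoint _ upper]) (use \<sigma>_pos \<sigma>_less in simp)

section \<open>The damped iteration with the squared operator\<close>

definition \<eta> :: real where "\<eta> = 2 / (\<Lambda>\<^sup>2 + \<sigma>\<^sup>2)"
definition \<theta> :: real where "\<theta> = (\<Lambda>\<^sup>2 - \<sigma>\<^sup>2) / (\<Lambda>\<^sup>2 + \<sigma>\<^sup>2)"
definition M :: "('i \<Rightarrow> 'e) \<Rightarrow> ('i \<Rightarrow> 'e)" where "M f = (\<lambda>i. f i - \<eta> *\<^sub>R H (H f) i)"

lemma squares_less: "\<sigma>\<^sup>2 < \<Lambda>\<^sup>2" "0 < \<sigma>\<^sup>2"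
  using \<sigma>_pos \<sigma>_less by (auto intro: power_strict_mono)

lemma \<theta>_bounds: "0 < \<theta>" "\<theta> < 1"
  unfolding \<theta>_def using ratio_bounds[OF squares_less(2,1)] by auto

lemma \<eta>_bounds: "0 < \<eta>" "1 - \<eta> * \<Lambda>\<^sup>2 = -\<theta>" "1 - \<eta> * \<sigma>\<^sup>2 = \<theta>" "\<eta> / (1 - \<theta>) = 1 / \<sigma>\<^sup>2"
  unfolding \<theta>_def \<eta>_def using ratio_bounds[OF squares_less(2,1)] by auto

lemma linM: "pointwise_linear M"
  unfolding pointwise_linear_def M_def
  by (simp add: pointwise_linear_add[OF linH] pointwise_linear_scale[OF linH] algebra_simps)

text \<open>The form of \<open>M\<close> is \<open>(nrm f)^2 - \<eta> * (nrm (H f))^2\<close>; the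
  two norm bounds on \<open>H\<close> confine it to \<open>[-\<theta>, \<theta>]\<close> times
  \<open>ip f f\<close>, and self-adjointness turns this into a norm bound.\<close>

lemma nrm_M_le: "nrm (M f) \<le> \<theta> * nrm f"
proof (rule selfadjoint_nrm_le[OF linM])
  show "ip (M f) g = ip f (M g)" for f g
    by (simp add: M_def ip_simps selfadjoint)
  show "\<bar>ip f (M f)\<bar> \<le> \<theta> * ip f f" for f
  proof -
    have e: "ip f (M f) = (nrm f)\<^sup>2 - \<eta> * (nrm (H f))\<^sup>2"
      by (simp add: M_def ip_simps selfadjoint[symmetric] nrm_power2)
    have "(nrm (H f))\<^sup>2 \<le> \<Lambda>\<^sup>2 * (nrm f)\<^sup>2" "\<sigma>\<^sup>2 * (nrm f)\<^sup>2 \<le> (nrm (H f))\<^sup>2"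
      using power_mono[OF nrm_H_le[of f], of 2] power_mono[OF lower[of f], of 2] \<sigma>_pos
      by (auto simp: power_mult_distrib)
    then have "\<eta> * (nrm (H f))\<^sup>2 \<le> \<eta> * (\<Lambda>\<^sup>2 * (nrm f)\<^sup>2)"
      "\<eta> * (\<sigma>\<^sup>2 * (nrm f)\<^sup>2) \<le> \<eta> * (nrm (H f))\<^sup>2"
      using \<eta>_bounds(1) by (auto intro: mult_left_mono)
    moreover have "(nrm f)\<^sup>2 - \<eta> * (\<Lambda>\<^sup>2 * (nrm f)\<^sup>2) = - \<theta> * (nrm f)\<^sup>2"
      "(nrm f)\<^sup>2 - \<eta> * (\<sigma>\<^sup>2 * (nrm f)\<^sup>2) = \<theta> * (nrm f)\<^sup>2"
      by (simp_all only: \<eta>_bounds(2)[symmetric], simp_all only: \<eta>_bounds(3)[symmetric]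
          left_diff_distrib mult.assoc mult_1)
    ultimately show ?thesis
      unfolding e nrm_power2[symmetric] by (simp add: abs_le_iff)
  qed
qed (rule \<theta>_bounds)

lemma linMk: "pointwise_linear (M ^^ k)"
proof (induction k)
  case (Suc k)
  then show ?case
    by (simp add: pointwise_linear_def pointwise_linear_add[OF linM] pointwise_linear_scale[OF linM])
qed (simp add: pointwise_linear_def)

lemma nrm_Mk_le: "nrm ((M ^^ k) f) \<le> \<theta> ^ k * nrm f"
proof (induction k)
  case (Suc k)
  have "nrm ((M ^^ Suc k) f) \<le> \<theta> * nrm ((M ^^ k) f)"
    using nrm_M_le by simp
  also have "\<dots> \<le> \<theta> * (\<theta> ^ k * nrm f)"
    using Suc \<theta>_bounds by (intro mult_left_mono) auto
  finally show ?case by (simp add: mult.assoc)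
qed simp

text \<open>The first \<open>H\<close> spreads data at level \<open>s\<close> by one level, and
  every \<open>M\<close> by two more because it contains \<open>H\<close> twice:
  \<open>2 * k + 1\<close> levels in all.\<close>

lemma banded_Mk:
  assumes f: "\<And>i. lev i \<noteq> s \<Longrightarrow> f i = 0" and far: "lev i > s + (2 * k + 1) \<or> s > lev i + (2 * k + 1)"
  shows "(M ^^ k) (H f) i = 0"
  using far
proof (induction k arbitrary: i)
  case 0
  have "H f i = 0"
    by (rule banded[of "{l. l \<noteq> s}"]) (use f 0 in auto)
  then show ?case by simp
next
  case (Suc k)
  let ?g = "(M ^^ k) (H f)"
  \<comment> \<open>One of the two applications of \<open>H\<close> widens the reach to
    \<open>2 * k + 2\<close>; the next gives the \<open>2 * k + 3\<close> of the induction
    step.\<close>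
  have Hg: "H ?g i' = 0" if "lev i' > s + (2 * k + 2) \<or> s > lev i' + (2 * k + 2)" for i'
    by (rule banded[of "{l. l > s + (2 * k + 1) \<or> s > l + (2 * k + 1)}"])
       (use Suc.IH that in auto)
  have "H (H ?g) i = 0"
    by (rule banded[of "{l. l > s + (2 * k + 2) \<or> s > l + (2 * k + 2)}"])
       (use Hg Suc.prems in auto)
  moreover have "?g i = 0"
    using Suc by auto
  ultimately show ?case
    by (simp add: M_def[of ?g])
qed

section \<open>Stagewise norms and decay of the Neumann series\<close>

definition lnrm :: "nat \<Rightarrow> ('i \<Rightarrow> 'e) \<Rightarrow> real" where
  "lnrm t f = nrm (\<lambda>i. if lev i = t then f i else 0)"

lemma lnrm_le_nrm: "lnrm t f \<le> nrm f"
  unfolding lnrm_def by (rule nrm_mono) auto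

lemma lnrm_triangle: "lnrm t (\<lambda>i. f i + g i) \<le> lnrm t f + lnrm t g"
proof -
  have "(\<lambda>i. if lev i = t then f i + g i else 0)
     = (\<lambda>i. (if lev i = t then f i else 0) + (if lev i = t then g i else 0))"
    by auto
  then show ?thesis
    using nrm_triangle[of "\<lambda>i. if lev i = t then f i else 0" "\<lambda>i. if lev i = t then g i else 0"]
    by (simp add: lnrm_def)
qed

lemma lnrm_sum: "lnrm t (\<lambda>i. \<Sum>k\<in>K. f k i) \<le> (\<Sum>k\<in>K. lnrm t (f k))"
proof (induction K rule: infinite_finite_induct)
  case (insert k K)
  then show ?case
    using lnrm_triangle[of t "f k" "\<lambda>i. \<Sum>k\<in>K. f k i"] by auto
qed (auto simp: lnrm_def)

text \<open>For the distance \<open>D\<close> of the two levels, \<open>D div 2 \<le> k\<close> is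
  the same as \<open>D \<le> 2 * k + 1\<close>; for smaller \<open>k\<close> the term has not yet
  reached level \<open>t\<close>.\<close>

lemma lnrm_Mk_level:
  assumes f: "\<And>i. lev i \<noteq> s \<Longrightarrow> f i = 0"
  shows "lnrm t (\<lambda>i. \<eta> *\<^sub>R (M ^^ k) (H f) i)
    \<le> (if (if t \<le> s then s - t else t - s) div 2 \<le> k then \<eta> * \<Lambda> * \<theta> ^ k * nrm f else 0)"
proof (cases "(if t \<le> s then s - t else t - s) div 2 \<le> k")
  case True
  have "lnrm t (\<lambda>i. \<eta> *\<^sub>R (M ^^ k) (H f) i) \<le> \<eta> * nrm ((M ^^ k) (H f))"
    using lnrm_le_nrm[of t "\<lambda>i. \<eta> *\<^sub>R (M ^^ k) (H f) i"] \<eta>_bounds by (simp add: nrm_scale)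
  also have "\<dots> \<le> \<eta> * (\<theta> ^ k * (\<Lambda> * nrm f))"
    using nrm_Mk_le[of k "H f"] nrm_H_le[of f] \<eta>_bounds \<theta>_bounds
    by (meson less_imp_le mult_left_mono order_trans zero_le_power)
  finally show ?thesis using True by (simp add: mult_ac)
next
  case False
  then have "(M ^^ k) (H f) i = 0" if "lev i = t" for i
    by (intro banded_Mk[of s]) (use f that in \<open>auto split: if_splits\<close>)
  then have "(\<lambda>i. if lev i = t then \<eta> *\<^sub>R (M ^^ k) (H f) i else 0) = (\<lambda>i. 0)"
    by auto
  then show ?thesis
    using False by (simp add: lnrm_def)
qed

text \<open>The tail starts at \<open>D div 2\<close>, and \<open>D \<le> 2 * (D div 2) + 1\<close>
  replaces the integer division at the price of one factor \<open>1 / sqrt \<theta>\<close>.\<close>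

lemma truncated_geometric_le:
  "(\<Sum>k<n. if D div 2 \<le> k then \<theta> ^ k else 0) \<le> sqrt \<theta> ^ D / (sqrt \<theta> * (1 - \<theta>))"
proof -
  let ?h = "D div 2"
  have "(\<Sum>k<n. if ?h \<le> k then \<theta> ^ k else 0) = (\<Sum>k\<in>{..<n} \<inter> {?h..}. \<theta> ^ k)"
    by (simp add: sum.If_cases Int_def atLeast_def)
  also have "{..<n} \<inter> {?h..} = {?h..<n}" by auto
  also have "(\<Sum>k\<in>{?h..<n}. \<theta> ^ k) = (\<Sum>k<n - ?h. \<theta> ^ ?h * \<theta> ^ k)"
    by (rule sum.reindex_bij_witness[where i = "\<lambda>k. k + ?h" and j = "\<lambda>k. k - ?h"])
       (auto simp: power_add[symmetric])
  also have "\<dots> = \<theta> ^ ?h * (\<Sum>k<n - ?h. \<theta> ^ k)"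
    by (simp add: sum_distrib_left)
  also have "(\<Sum>k<n - ?h. \<theta> ^ k) \<le> 1 / (1 - \<theta>)"
    using \<theta>_bounds by (subst sum_gp_strict) (auto intro!: divide_right_mono)
  finally have 1: "(\<Sum>k<n. if ?h \<le> k then \<theta> ^ k else 0) \<le> \<theta> ^ ?h / (1 - \<theta>)"
    using \<theta>_bounds by (simp add: mult_left_mono)
  have "\<theta> ^ ?h * sqrt \<theta> = sqrt \<theta> ^ (2 * ?h + 1)"
    using \<theta>_bounds by (simp add: power_mult)
  also have "\<dots> \<le> sqrt \<theta> ^ D"
    using \<theta>_bounds by (intro power_decreasing) auto
  finally have "\<theta> ^ ?h \<le> sqrt \<theta> ^ D / sqrt \<theta>"
    using \<theta>_bounds by (simp add: field_simps)
  then have "\<theta> ^ ?h / (1 - \<theta>) \<le> sqrt \<theta> ^ D / sqrt \<theta> / (1 - \<theta>)"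
    using \<theta>_bounds by (intro divide_right_mono) auto
  with 1 show ?thesis by simp
qed

text \<open>The limit of the series solves the equation multiplied by \<open>H\<close>, and
  \<open>lower\<close> cancels that extra \<open>H\<close>. \<open>S\<close> holds the finitely many
  occurring levels, by which the data are split.\<close>

theorem solution_decay:
  assumes S: "finite S" "\<And>j. j \<in> J \<Longrightarrow> lev (nu j) \<in> S"
  obtains v where "\<And>j. j \<in> J \<Longrightarrow> H v (nu j) = b (nu j)"
    "\<And>t. lnrm t v \<le> \<Lambda> / (\<sigma>\<^sup>2 * sqrt \<theta>) *
       (\<Sum>s\<in>S. sqrt \<theta> ^ (if t \<le> s then s - t else t - s) * lnrm s b)"
proof -
  define g where "g k = (\<lambda>i. \<eta> *\<^sub>R (M ^^ k) (H b) i)" for k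
  define V where "V k = (\<lambda>i. \<Sum>l<k. g l i)" for k
  \<comment> \<open>Convergence is shown only at the points \<open>nu j\<close>; elsewhere the value
    of the infinite sum is invisible to the seminorm.\<close>
  define v where "v = (\<lambda>i. \<Sum>l. g l i)"
  have gS: "g (Suc k) = M (g k)" for k
    by (simp add: g_def pointwise_linear_scale[OF linM])
  have V_lim: "(\<lambda>k. V k (nu j)) \<longlonglongrightarrow> v (nu j)" if j: "j \<in> J" for j
  proof -
    have "summable (\<lambda>l. g l (nu j))"
    proof (rule summable_comparison_test')
      fix l :: nat
      have "norm (g l (nu j)) \<le> nrm (g l) / sqrt (m j)"
        by (rule norm_le_nrm[OF j])
      also have "nrm (g l) \<le> \<eta> * nrm (H b) * \<theta> ^ l"
        using nrm_Mk_le[of l "H b"] \<eta>_bounds(1) by (simp add: g_def nrm_scale mult_ac)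
      finally show "norm (g l (nu j)) \<le> \<eta> * nrm (H b) / sqrt (m j) * \<theta> ^ l"
        using m_pos[OF j] by (simp add: divide_right_mono)
    qed (use \<theta>_bounds in \<open>auto intro!: summable_mult summable_geometric\<close>)
    then show ?thesis
      unfolding V_def v_def by (rule summable_LIMSEQ)
  qed
  have V_nrm: "(\<lambda>k. nrm (\<lambda>i. v i - V k i)) \<longlonglongrightarrow> 0"
  proof (rule nrm_tendsto_0)
    fix j assume "j \<in> J"
    from tendsto_diff[OF tendsto_const[of "v (nu j)"] V_lim[OF this]]
    show "(\<lambda>k. v (nu j) - V k (nu j)) \<longlonglongrightarrow> 0"
      by simp
  qed
  have VS: "V (Suc k) = (\<lambda>i. g 0 i + M (V k) i)" for k
  proof -
    have "M (V k) = (\<lambda>i. \<Sum>l<k. g (Suc l) i)"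
      unfolding V_def gS by (rule pointwise_linear_sum[OF linM])
    then show ?thesis
      by (simp add: V_def sum.lessThan_Suc_shift del: sum.lessThan_Suc)
  qed

  \<comment> \<open>The residual equals \<open>v - V (Suc k)\<close> minus \<open>M\<close> applied
    to \<open>v - V k\<close>; both parts tend to zero in the seminorm.\<close>
  have fixpt: "nrm (\<lambda>i. v i - (g 0 i + M v i)) = 0"
  proof -
    have "nrm (\<lambda>i. v i - (g 0 i + M v i))
        \<le> nrm (\<lambda>i. v i - V (Suc k) i) + \<theta> * nrm (\<lambda>i. v i - V k i)" for k
    proof -
      have "(\<lambda>i. v i - (g 0 i + M v i)) = (\<lambda>i. (v i - V (Suc k) i) - M (\<lambda>i. v i - V k i) i)"
        by (simp add: VS pointwise_linear_diff[OF linM] algebra_simps)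
      then show ?thesis
        using nrm_diff_le[of "\<lambda>i. v i - V (Suc k) i" "M (\<lambda>i. v i - V k i)"]
          nrm_M_le[of "\<lambda>i. v i - V k i"] by simp
    qed
    moreover have "(\<lambda>k. nrm (\<lambda>i. v i - V (Suc k) i) + \<theta> * nrm (\<lambda>i. v i - V k i)) \<longlonglongrightarrow> 0 + \<theta> * 0"
      by (intro tendsto_intros V_nrm LIMSEQ_Suc[OF V_nrm])
    ultimately have "nrm (\<lambda>i. v i - (g 0 i + M v i)) \<le> 0 + \<theta> * 0"
      by (meson LIMSEQ_le_const)
    then show ?thesis
      using nrm_ge_0 by (metis add_0 mult_zero_right order_antisym)
  qed
  \<comment> \<open>Since \<open>g 0\<close> is \<open>\<eta>\<close> times \<open>H b\<close> and
    \<open>M\<close> is the identity minus \<open>\<eta>\<close> times the square of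
    \<open>H\<close>, the fixed-point equation reads \<open>H (H v - b) = 0\<close>.\<close>
  have "(\<lambda>i. v i - (g 0 i + M v i)) = (\<lambda>i. \<eta> *\<^sub>R H (\<lambda>i. H v i - b i) i)"
    by (simp add: g_def M_def pointwise_linear_diff[OF linH] algebra_simps)
  with fixpt have "nrm (H (\<lambda>i. H v i - b i)) = 0"
    using \<eta>_bounds(1) by (simp add: nrm_scale)
  with lower[of "\<lambda>i. H v i - b i"] have "nrm (\<lambda>i. H v i - b i) = 0"
    using \<sigma>_pos nrm_ge_0[of "\<lambda>i. H v i - b i"] by (simp add: mult_le_0_iff)
  then have sol: "H v (nu j) = b (nu j)" if "j \<in> J" for j
    using that by (simp add: nrm_eq_0_iff)

  define bl where "bl s = (\<lambda>i. if lev i = s then b i else 0)" for s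
  \<comment> \<open>\<open>b\<close> equals the sum of its level parts only at the points
    \<open>nu j\<close>. The difference has seminorm zero, and the norm bounds keep it zero under
    \<open>H\<close> and the iterates of \<open>M\<close>.\<close>
  have H_bl: "nrm (\<lambda>i. g l i - (\<Sum>s\<in>S. \<eta> *\<^sub>R (M ^^ l) (H (bl s)) i)) = 0" for l
  proof -
    have 0: "nrm (\<lambda>i. b i - (\<Sum>s\<in>S. bl s i)) = 0"
      using S by (auto simp: nrm_eq_0_iff bl_def)
    have "(\<lambda>i. g l i - (\<Sum>s\<in>S. \<eta> *\<^sub>R (M ^^ l) (H (bl s)) i))
        = (\<lambda>i. \<eta> *\<^sub>R (M ^^ l) (H (\<lambda>i. b i - (\<Sum>s\<in>S. bl s i))) i)"
      unfolding g_def pointwise_linear_diff[OF linH] pointwise_linear_sum[OF linH]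
        pointwise_linear_diff[OF linMk] pointwise_linear_sum[OF linMk]
      by (simp only: scaleR_right_diff_distrib scaleR_sum_right)
    then have "nrm (\<lambda>i. g l i - (\<Sum>s\<in>S. \<eta> *\<^sub>R (M ^^ l) (H (bl s)) i))
        = \<eta> * nrm ((M ^^ l) (H (\<lambda>i. b i - (\<Sum>s\<in>S. bl s i))))"
      using \<eta>_bounds(1) by (simp add: nrm_scale)
    moreover have "nrm (H (\<lambda>i. b i - (\<Sum>s\<in>S. bl s i))) = 0"
      using nrm_H_le[of "\<lambda>i. b i - (\<Sum>s\<in>S. bl s i)"] unfolding 0
      by (metis mult_zero_right nrm_ge_0 order_antisym)
    then have "nrm ((M ^^ l) (H (\<lambda>i. b i - (\<Sum>s\<in>S. bl s i)))) = 0"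
      using nrm_Mk_le[of l "H (\<lambda>i. b i - (\<Sum>s\<in>S. bl s i))"]
      by (metis mult_zero_right nrm_ge_0 order_antisym)
    ultimately show ?thesis by simp
  qed
  let ?D = "\<lambda>t s. if t \<le> s then s - t else t - s :: nat"
  let ?bound = "\<lambda>t. \<Lambda> / (\<sigma>\<^sup>2 * sqrt \<theta>) * (\<Sum>s\<in>S. sqrt \<theta> ^ ?D t s * lnrm s b)"
  have V_le: "lnrm t (V n) \<le> ?bound t" for t n
  proof -
    have gl: "lnrm t (g l) \<le> (\<Sum>s\<in>S. \<eta> * \<Lambda> * lnrm s b * (if ?D t s div 2 \<le> l then \<theta> ^ l else 0))" for l
    proof -
      have eq: "g l (nu j) = (\<Sum>s\<in>S. \<eta> *\<^sub>R (M ^^ l) (H (bl s)) (nu j))" if "j \<in> J" for j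
        using H_bl[of l] that by (auto simp: nrm_eq_0_iff)
      have "lnrm t (g l) = lnrm t (\<lambda>i. \<Sum>s\<in>S. \<eta> *\<^sub>R (M ^^ l) (H (bl s)) i)"
        unfolding lnrm_def by (rule nrm_cong) (simp add: eq)
      also have "\<dots> \<le> (\<Sum>s\<in>S. lnrm t (\<lambda>i. \<eta> *\<^sub>R (M ^^ l) (H (bl s)) i))"
        by (rule lnrm_sum)
      also have "\<dots> \<le> (\<Sum>s\<in>S. \<eta> * \<Lambda> * lnrm s b * (if ?D t s div 2 \<le> l then \<theta> ^ l else 0))"
      proof (rule sum_mono)
        fix s assume "s \<in> S"
        have nb: "nrm (bl s) = lnrm s b"
          by (simp add: bl_def lnrm_def)
        show "lnrm t (\<lambda>i. \<eta> *\<^sub>R (M ^^ l) (H (bl s)) i)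
            \<le> \<eta> * \<Lambda> * lnrm s b * (if ?D t s div 2 \<le> l then \<theta> ^ l else 0)"
          by (rule order_trans[OF lnrm_Mk_level[of s]]) (auto simp: bl_def lnrm_def)
      qed
      finally show ?thesis .
    qed
    have "lnrm t (V n) \<le> (\<Sum>l<n. lnrm t (g l))"
      unfolding V_def by (rule lnrm_sum)
    also have "\<dots> \<le> (\<Sum>l<n. \<Sum>s\<in>S. \<eta> * \<Lambda> * lnrm s b * (if ?D t s div 2 \<le> l then \<theta> ^ l else 0))"
      by (rule sum_mono) (rule gl)
    also have "\<dots> = (\<Sum>s\<in>S. \<eta> * \<Lambda> * lnrm s b * (\<Sum>l<n. if ?D t s div 2 \<le> l then \<theta> ^ l else 0))"
      by (subst sum.swap) (simp add: sum_distrib_left)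
    also have "\<dots> \<le> (\<Sum>s\<in>S. \<eta> * \<Lambda> * lnrm s b * (sqrt \<theta> ^ ?D t s / (sqrt \<theta> * (1 - \<theta>))))"
      by (intro sum_mono mult_left_mono truncated_geometric_le)
         (use \<eta>_bounds(1) \<sigma>_pos \<sigma>_less in \<open>auto simp: lnrm_def\<close>)
    also have "\<dots> = (\<Sum>s\<in>S. \<Lambda> * (\<eta> / (1 - \<theta>)) / sqrt \<theta> * (sqrt \<theta> ^ ?D t s * lnrm s b))"
      by (intro sum.cong refl) (simp add: mult_ac)
    also have "\<dots> = ?bound t"
      unfolding \<eta>_bounds(4) by (simp add: sum_distrib_left)
    finally show ?thesis .
  qed
  have "lnrm t v \<le> ?bound t" for t
  proof -
    have "lnrm t v \<le> ?bound t + nrm (\<lambda>i. v i - V n i)" for n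
      using lnrm_triangle[of t "V n" "\<lambda>i. v i - V n i"] V_le[of t n]
        lnrm_le_nrm[of t "\<lambda>i. v i - V n i"] by simp
    moreover have "(\<lambda>n. ?bound t + nrm (\<lambda>i. v i - V n i)) \<longlonglongrightarrow> ?bound t + 0"
      by (intro tendsto_intros V_nrm)
    ultimately have "lnrm t v \<le> ?bound t + 0"
      by (meson LIMSEQ_le_const)
    then show ?thesis by simp
  qed
  with sol show ?thesis
    by (intro that[of v])
qed

end

section \<open>Square roots of positive semidefinite matrices\<close>

text \<open>A nonnegative form attains its minimum at \<open>v\<close>, so its first variation
  vanishes in every direction of \<open>U\<close>; otherwise the parabola in \<open>s\<close> would
  become negative near 0.\<close>

lemma psd_form_zero:
  fixes B :: "'a::real_inner \<Rightarrow> 'a"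
  assumes lin: "linear B" and sa: "\<And>x y. B x \<bullet> y = x \<bullet> B y" and U: "subspace U"
    and nn: "\<And>x. x \<in> U \<Longrightarrow> 0 \<le> x \<bullet> B x" and v: "v \<in> U" "v \<bullet> B v = 0" and y: "y \<in> U"
  shows "B v \<bullet> y = 0"
proof (rule ccontr)
  assume ne: "B v \<bullet> y \<noteq> 0"
  define c where "c = y \<bullet> B y"
  have Byv: "B y \<bullet> v = B v \<bullet> y"
    by (metis sa inner_commute)
  have c0: "0 \<le> c" using nn[OF y] by (simp add: c_def)
  have *: "0 \<le> 2 * s * (B v \<bullet> y) + s\<^sup>2 * c" for s
  proof -
    have "0 \<le> (v + s *\<^sub>R y) \<bullet> B (v + s *\<^sub>R y)"
      using U v y by (intro nn) (simp add: subspace_add subspace_scale)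
    also have "\<dots> = 2 * s * (B v \<bullet> y) + s\<^sup>2 * c"
      using v(2)[folded sa] by (simp add: linear_add[OF lin] linear_scale[OF lin] inner_simps c_def
          power2_eq_square sa[symmetric] Byv algebra_simps)
    finally show ?thesis .
  qed
  \<comment> \<open>The minimizing step would divide by \<open>c\<close>; \<open>c + 1\<close> keeps
    the denominator positive when the quadratic term vanishes.\<close>
  define s where "s = - (B v \<bullet> y) / (c + 1)"
  have sc: "s * (c + 1) = - (B v \<bullet> y)"
    using c0 by (simp add: s_def)
  have "(c + 1)\<^sup>2 * (2 * s * (B v \<bullet> y) + s\<^sup>2 * c)
      = 2 * (c + 1) * (s * (c + 1)) * (B v \<bullet> y) + (s * (c + 1))\<^sup>2 * c"
    by (simp add: algebra_simps power2_eq_square)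
  also have "\<dots> = - ((c + 2) * (B v \<bullet> y)\<^sup>2)"
    unfolding sc by (simp add: algebra_simps power2_eq_square)
  also have "\<dots> < 0"
    using c0 ne by simp
  finally show False
    using *[of s] by (simp add: mult_less_0_iff)
qed

text \<open>\<open>v\<close> maximizes the Rayleigh quotient on the unit sphere of \<open>U\<close>.
  Then \<open>c *\<^sub>R x - f x\<close> defines a nonnegative form on \<open>U\<close> that
  vanishes at \<open>v\<close>, and \<open>psd_form_zero\<close> with \<open>y = B v\<close> yields
  \<open>B v = 0\<close>.\<close>

lemma selfadjoint_eigenvector:
  fixes f :: "'a::euclidean_space \<Rightarrow> 'a"
  assumes lin: "linear f" and sa: "\<And>x y. f x \<bullet> y = x \<bullet> f y"
    and U: "subspace U" "f ` U \<subseteq> U" "U \<noteq> {0}"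
  obtains v c where "v \<in> U" "norm v = 1" "f v = c *\<^sub>R v"
proof -
  let ?S = "sphere 0 1 \<inter> U"
  obtain u where u: "u \<in> U" "u \<noteq> 0"
    using U(1,3) subspace_0[OF U(1)] by auto
  have "(1 / norm u) *\<^sub>R u \<in> ?S"
    using u U(1) by (simp add: subspace_scale)
  then have ne: "?S \<noteq> {}" by blast
  have cpt: "compact ?S"
    by (intro compact_Int_closed compact_sphere closed_subspace U(1))
  have "continuous_on ?S (\<lambda>x. x \<bullet> f x)"
    by (intro continuous_intros linear_continuous_on linear_conv_bounded_linear[THEN iffD1] lin)
  then obtain v where v: "v \<in> ?S" and max: "\<And>x. x \<in> ?S \<Longrightarrow> x \<bullet> f x \<le> v \<bullet> f v"
    using continuous_attains_sup[OF cpt ne] by blast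
  define c where "c = v \<bullet> f v"
  define B where "B x = c *\<^sub>R x - f x" for x
  have vU: "v \<in> U" "norm v = 1" using v by auto
  have vv: "v \<bullet> v = 1" using vU(2) by (simp add: norm_eq_1)
  have "B v \<bullet> y = 0" if "y \<in> U" for y
  proof (rule psd_form_zero[of B U])
    show "linear B"
      unfolding B_def
      by (intro linear_compose_sub linear_compose_scale_right lin linear_ident)
    show "B x \<bullet> y = x \<bullet> B y" for x y
      by (simp add: B_def inner_simps sa)
    show "0 \<le> x \<bullet> B x" if x: "x \<in> U" for x
    proof (cases "x = 0")
      case False
      have "((1 / norm x) *\<^sub>R x) \<bullet> f ((1 / norm x) *\<^sub>R x) \<le> c"
        unfolding c_def using x False U(1) by (intro max) (simp add: subspace_scale)
      then have "x \<bullet> f x \<le> c * (norm x)\<^sup>2"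
        using False by (simp add: linear_scale[OF lin] field_simps power2_eq_square)
      then show ?thesis
        by (simp add: B_def inner_simps power2_norm_eq_inner)
    qed (simp add: B_def)
    show "v \<bullet> B v = 0"
      using vv by (simp add: B_def inner_simps c_def)
  qed (use U vU that in auto)
  moreover have "B v \<in> U"
    using U vU by (auto simp: B_def intro!: subspace_diff subspace_scale)
  ultimately have "B v \<bullet> B v = 0" by blast
  then have "f v = c *\<^sub>R v" by (simp add: B_def)
  with vU show ?thesis by (rule that)
qed

text \<open>The form for invariant subspaces lets the induction on the dimension pass to the
  orthogonal complement of an eigenvector inside \<open>U\<close>, which is invariant by
  self-adjointness.\<close>

lemma selfadjoint_eigenbasis_subspace:
  fixes f :: "'a::euclidean_space \<Rightarrow> 'a"
  assumes lin: "linear f" and sa: "\<And>x y. f x \<bullet> y = x \<bullet> f y"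
  shows "subspace U \<Longrightarrow> f ` U \<subseteq> U \<Longrightarrow>
    \<exists>E ev. finite E \<and> pairwise orthogonal E \<and> (\<forall>e\<in>E. norm e = 1 \<and> f e = ev e *\<^sub>R e) \<and> span E = U"
proof (induction "dim U" arbitrary: U rule: less_induct)
  case less
  show ?case
  proof (cases "U = {0}")
    case True
    then show ?thesis
      by (intro exI[of _ "{}"]) auto
  next
    case False
    obtain v c where v: "v \<in> U" "norm v = 1" "f v = c *\<^sub>R v"
      using selfadjoint_eigenvector[OF lin sa less.prems False] by blast
    have vv: "v \<bullet> v = 1" using v(2) by (simp add: norm_eq_1)
    define U' where "U' = U \<inter> {x. v \<bullet> x = 0}"
    have sub: "subspace U'"
      unfolding U'_def by (intro subspace_inter less.prems subspace_hyperplane)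
    have inv: "f ` U' \<subseteq> U'"
      using less.prems v by (auto simp: U'_def sa[symmetric])
    have "dim U' < dim U"
    proof (rule ccontr)
      assume "\<not> dim U' < dim U"
      then have "U' = U"
        using subspace_dim_equal[OF sub less.prems(1)] by (auto simp: U'_def)
      then have "v \<in> U'" using v(1) by simp
      then show False using vv by (simp add: U'_def)
    qed
    from less.hyps[OF this sub inv] obtain E ev where
      E: "finite E" "pairwise orthogonal E" "\<forall>e\<in>E. norm e = 1 \<and> f e = ev e *\<^sub>R e" "span E = U'"
      by blast
    have vE: "v \<bullet> e = 0" if "e \<in> E" for e
    proof -
      have "e \<in> U'" using span_base[OF that] unfolding E(4) .
      then show ?thesis by (simp add: U'_def)
    qed
    have nE: "v \<notin> E" using vE[of v] vv by auto
    have "span (insert v E) = U"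
    proof
      have "insert v E \<subseteq> U"
        using v(1) E(4) span_superset[of E] by (auto simp: U'_def)
      then show "span (insert v E) \<subseteq> U"
        using less.prems(1) by (rule span_minimal)
      show "U \<subseteq> span (insert v E)"
      proof
        fix x assume x: "x \<in> U"
        have "x - (v \<bullet> x) *\<^sub>R v \<in> U'"
          using x v(1) vv less.prems(1)
          by (auto simp: U'_def inner_simps intro!: subspace_diff subspace_scale)
        then show "x \<in> span (insert v E)"
          unfolding span_insert E(4) by blast
      qed
    qed
    moreover have "pairwise orthogonal (insert v E)"
      using E(2) vE by (auto simp: pairwise_insert orthogonal_def inner_commute)
    moreover have "\<forall>e\<in>insert v E. norm e = 1 \<and> f e = (ev(v := c)) e *\<^sub>R e"
      using E(3) v nE by auto
    ultimately show ?thesis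
      using E(1) by (intro exI[of _ "insert v E"] exI[of _ "ev(v := c)"]) simp
  qed
qed

text \<open>Uniqueness is what gives the definite description in \<open>msqrt\<close> its meaning.
  The root acts as \<open>sqrt (ev e)\<close> on an orthonormal eigenbasis of \<open>Q\<close>, and
  any other root is compared with it there.\<close>

lemma ex_psd_sqrt:
  fixes Q :: "real^'n^'n"
  assumes Q: "psd Q"
  shows "\<exists>!S. psd S \<and> S ** S = Q"
proof -
  have adj: "(N *v x) \<bullet> y = x \<bullet> (N *v y)" if "transpose N = N" for N :: "real^'n^'n" and x y
    using that by (metis dot_lmul_matrix transpose_matrix_vector)
  have Qt: "transpose Q = Q" and Qp: "\<And>x. 0 \<le> x \<bullet> (Q *v x)"
    using Q by (auto simp: psd_def)
  obtain E ev where E: "finite E" "pairwise orthogonal E"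
    "\<And>e. e \<in> E \<Longrightarrow> norm e = 1" "\<And>e. e \<in> E \<Longrightarrow> Q *v e = ev e *\<^sub>R e" "span E = UNIV"
    using selfadjoint_eigenbasis_subspace[of "(*v) Q" UNIV] adj[OF Qt]
    by (metis matrix_vector_mul_linear subset_UNIV subspace_UNIV)
  have EE: "e \<bullet> e' = (if e = e' then 1 else 0)" if "e \<in> E" "e' \<in> E" for e e'
    using E(2,3) that by (auto simp: pairwise_def orthogonal_def norm_eq_1)
  have ev: "0 \<le> ev e" if "e \<in> E" for e
    using Qp[of e] E(4)[OF that] EE[OF that that] by simp
  have mat_eq: "N = N'" if "\<And>e. e \<in> E \<Longrightarrow> N *v e = N' *v e" for N N' :: "real^'n^'n"
  proof -
    have "N *v x = N' *v x" for x
      by (rule linear_eq_on_span[of "(*v) N" "(*v) N'" E x]) (use that E(5) in auto)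
    then show ?thesis by (simp add: matrix_eq)
  qed
  define g where "g x = (\<Sum>e\<in>E. (sqrt (ev e) * (e \<bullet> x)) *\<^sub>R e)" for x
  have lg: "linear g"
    unfolding g_def
    by (rule linearI) (simp_all add: inner_right_distrib distrib_left scaleR_add_left sum.distrib
        scaleR_sum_right mult.left_commute)
  define S where "S = matrix g"
  have Sg: "S *v x = g x" for x
    using fun_cong[OF matrix_vector_mul(2)[OF lg], of x] by (simp add: S_def)
  have Se: "S *v e = sqrt (ev e) *\<^sub>R e" if "e \<in> E" for e
  proof -
    have "g e = (\<Sum>e'\<in>E. if e' = e then sqrt (ev e) *\<^sub>R e else 0)"
      unfolding g_def using EE that by (intro sum.cong) auto
    then show ?thesis using E(1) that by (simp add: Sg)
  qed
  have "S ** S = Q"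
    using ev by (intro mat_eq)
      (simp add: matrix_vector_mul_assoc[symmetric] Se E(4) matrix_vector_mult_scaleR)
  moreover have "psd S"
  proof -
    have "x \<bullet> g y = g x \<bullet> y" for x y
      by (simp add: g_def inner_sum_left inner_sum_right inner_commute mult_ac)
    then have "(transpose S *v x) \<bullet> y = (S *v x) \<bullet> y" for x y
      by (simp add: transpose_matrix_vector dot_lmul_matrix Sg)
    then have "transpose S *v x = S *v x" for x
      using vector_eq_rdot by blast
    then have "transpose S = S" by (simp add: matrix_eq)
    moreover have "0 \<le> x \<bullet> (S *v x)" for x
      unfolding Sg g_def inner_sum_right
      by (intro sum_nonneg) (simp add: ev inner_commute mult.assoc)
    ultimately show ?thesis by (simp add: psd_def)
  qed
  moreover have "S' = S" if S': "psd S'" "S' ** S' = Q" for S'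
  proof (rule mat_eq)
    fix e assume e: "e \<in> E"
    have t: "transpose S' = S'" and p: "\<And>x. 0 \<le> x \<bullet> (S' *v x)"
      using S' by (auto simp: psd_def)
    have SS: "S' *v (S' *v e) = ev e *\<^sub>R e"
      by (simp add: matrix_vector_mul_assoc S'(2) E(4)[OF e])
    \<comment> \<open>\<open>S'\<close> maps \<open>y\<close> to \<open>- sqrt (ev e)\<close> times
      \<open>y\<close>, so positivity of \<open>S'\<close> leaves only \<open>y = 0\<close> or
      \<open>ev e = 0\<close>; in the second case \<open>S' *v e\<close> has norm 0.\<close>
    define y where "y = S' *v e - sqrt (ev e) *\<^sub>R e"
    have Sy: "S' *v y = - sqrt (ev e) *\<^sub>R y"
      using ev[OF e]
      by (simp add: y_def matrix_vector_mult_diff_distrib matrix_vector_mult_scaleR SS algebra_simps)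
    have "sqrt (ev e) * (y \<bullet> y) \<le> 0"
      using p[of y] unfolding Sy by simp
    then have "ev e = 0 \<or> y = 0"
      using ev[OF e] mult_pos_pos[of "sqrt (ev e)" "y \<bullet> y"] by (fastforce simp: less_le)
    moreover have "y = 0" if "ev e = 0"
    proof -
      have "(S' *v e) \<bullet> (S' *v e) = 0"
        unfolding adj[OF t] SS using that by simp
      then show ?thesis using that by (simp add: y_def)
    qed
    ultimately show "S' *v e = S *v e"
      by (auto simp: Se[OF e] y_def)
  qed
  ultimately show ?thesis by blast
qed

text \<open>Links detectability, which is stated with the root, to the stage cost, which is stated
  with \<open>Q\<close>.\<close>

lemma norm_msqrt:
  fixes Q :: "real^'n^'n"
  assumes "psd Q"
  shows "(norm (msqrt Q *v x))\<^sup>2 = x \<bullet> (Q *v x)"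
proof -
  have S: "psd (msqrt Q) \<and> msqrt Q ** msqrt Q = Q"
    unfolding msqrt_def by (rule theI'[OF ex_psd_sqrt[OF assms]])
  then have "(msqrt Q *v x) \<bullet> (msqrt Q *v x) = x \<bullet> (msqrt Q *v (msqrt Q *v x))"
    unfolding psd_def by (metis dot_lmul_matrix transpose_matrix_vector)
  then show ?thesis
    using S by (simp add: power2_norm_eq_inner matrix_vector_mul_assoc)
qed

section \<open>Stable linear recursions\<close>

lemma spec_norm_bound: "norm (M *v x) \<le> spec_norm M * norm x"
  unfolding spec_norm_def by (rule onorm[OF matrix_vector_mul_bounded_linear])

lemma norm_mult_vec_le: "spec_norm M \<le> c \<Longrightarrow> norm (M *v x) \<le> c * norm x"
  using spec_norm_bound[of M x] mult_right_mono[of "spec_norm M" c "norm x"] by simp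

lemma sum_power_le:
  fixes \<alpha> :: real
  assumes "0 \<le> \<alpha>" "\<alpha> < 1" "finite K" "inj_on k K"
  shows "(\<Sum>i\<in>K. \<alpha> ^ k i) \<le> 1 / (1 - \<alpha>)"
proof -
  have "(\<Sum>i\<in>K. \<alpha> ^ k i) = (\<Sum>j\<in>k ` K. \<alpha> ^ j)"
    using assms by (simp add: sum.reindex)
  also have "\<dots> \<le> (\<Sum>j. \<alpha> ^ j)"
    using assms by (intro sum_le_suminf) (auto intro: summable_geometric)
  finally show ?thesis
    using assms by (simp add: suminf_geometric)
qed

text \<open>Schur's test for the kernel \<open>c t s = \<alpha>^(t - s)\<close>, \<open>s \<le> t\<close>.\<close>

lemma geometric_convolution_l2:
  fixes a e :: "nat \<Rightarrow> real"
  assumes \<alpha>: "0 \<le> \<alpha>" "\<alpha> < 1" and L: "0 \<le> L"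
    and a: "\<And>t. t \<in> {\<tau>..N} \<Longrightarrow> \<bar>a t\<bar> \<le> (\<Sum>s=\<tau>..t. L * \<alpha> ^ (t - s) * e s)"
  shows "(\<Sum>t=\<tau>..N. (a t)\<^sup>2) \<le> (L / (1 - \<alpha>))\<^sup>2 * (\<Sum>t=\<tau>..N. (e t)\<^sup>2)"
proof -
  define c where "c t s = (if s \<le> t then \<alpha> ^ (t - s) else 0)" for t s :: nat
  have c0: "0 \<le> c t s" for t s
    using \<alpha> by (simp add: c_def)
  have row: "(\<Sum>s=\<tau>..N. c t s) \<le> 1 / (1 - \<alpha>)" for t
  proof -
    have "(\<Sum>s=\<tau>..N. c t s) = (\<Sum>s\<in>{s\<in>{\<tau>..N}. s \<le> t}. \<alpha> ^ (t - s))"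
      unfolding c_def by (rule sum.inter_filter[symmetric]) simp
    also have "\<dots> \<le> 1 / (1 - \<alpha>)"
      by (rule sum_power_le) (use \<alpha> in \<open>auto simp: inj_on_def\<close>)
    finally show ?thesis .
  qed
  have col: "(\<Sum>t=\<tau>..N. c t s) \<le> 1 / (1 - \<alpha>)" for s
  proof -
    have "(\<Sum>t=\<tau>..N. c t s) = (\<Sum>t\<in>{t\<in>{\<tau>..N}. s \<le> t}. \<alpha> ^ (t - s))"
      unfolding c_def by (rule sum.inter_filter[symmetric]) simp
    also have "\<dots> \<le> 1 / (1 - \<alpha>)"
      by (rule sum_power_le) (use \<alpha> in \<open>auto simp: inj_on_def\<close>)
    finally show ?thesis .
  qed
  have "(a t)\<^sup>2 \<le> L\<^sup>2 / (1 - \<alpha>) * (\<Sum>s=\<tau>..N. c t s * (e s)\<^sup>2)" if t: "t \<in> {\<tau>..N}" for t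
  proof -
    have "(\<Sum>s=\<tau>..t. L * \<alpha> ^ (t - s) * e s) = (\<Sum>s\<in>{s\<in>{\<tau>..N}. s \<le> t}. L * \<alpha> ^ (t - s) * e s)"
      using t by (intro sum.cong) auto
    also have "\<dots> = (\<Sum>s=\<tau>..N. if s \<le> t then L * \<alpha> ^ (t - s) * e s else 0)"
      by (rule sum.inter_filter) simp
    also have "\<dots> = L * (\<Sum>s=\<tau>..N. c t s * e s)"
      by (simp add: c_def sum_distrib_left if_distrib if_distribR mult.assoc cong: if_cong)
    \<comment> \<open>Splitting the kernel into two square roots lets Cauchy-Schwarz leave one copy
      for the row sum and one for the later column sum.\<close>
    also have "\<dots> = L * (\<Sum>s=\<tau>..N. sqrt (c t s) * (sqrt (c t s) * e s))"
      using c0 by (simp flip: mult.assoc)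
    finally have "\<bar>a t\<bar> \<le> \<bar>L * (\<Sum>s=\<tau>..N. sqrt (c t s) * (sqrt (c t s) * e s))\<bar>"
      using a[OF t] by linarith
    then have "(a t)\<^sup>2 \<le> L\<^sup>2 * (\<Sum>s=\<tau>..N. sqrt (c t s) * (sqrt (c t s) * e s))\<^sup>2"
      by (simp add: abs_le_square_iff power_mult_distrib)
    also have "\<dots> \<le> L\<^sup>2 * ((\<Sum>s=\<tau>..N. (sqrt (c t s))\<^sup>2) * (\<Sum>s=\<tau>..N. (sqrt (c t s) * e s)\<^sup>2))"
      by (intro mult_left_mono Cauchy_Schwarz_ineq_sum) simp
    also have "\<dots> = L\<^sup>2 * ((\<Sum>s=\<tau>..N. c t s) * (\<Sum>s=\<tau>..N. c t s * (e s)\<^sup>2))"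
      using c0 by (simp add: power_mult_distrib)
    also have "\<dots> \<le> L\<^sup>2 * (1 / (1 - \<alpha>) * (\<Sum>s=\<tau>..N. c t s * (e s)\<^sup>2))"
      by (intro mult_left_mono mult_right_mono row sum_nonneg mult_nonneg_nonneg c0) auto
    finally show ?thesis by simp
  qed
  then have "(\<Sum>t=\<tau>..N. (a t)\<^sup>2) \<le> (\<Sum>t=\<tau>..N. L\<^sup>2 / (1 - \<alpha>) * (\<Sum>s=\<tau>..N. c t s * (e s)\<^sup>2))"
    by (rule sum_mono)
  also have "\<dots> = L\<^sup>2 / (1 - \<alpha>) * (\<Sum>s=\<tau>..N. (\<Sum>t=\<tau>..N. c t s) * (e s)\<^sup>2)"
    unfolding sum_distrib_left[symmetric] sum_distrib_right
    by (subst sum.swap) simp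
  also have "\<dots> \<le> L\<^sup>2 / (1 - \<alpha>) * (\<Sum>s=\<tau>..N. 1 / (1 - \<alpha>) * (e s)\<^sup>2)"
    using \<alpha> by (intro mult_left_mono sum_mono mult_right_mono col) auto
  also have "\<dots> = (L / (1 - \<alpha>))\<^sup>2 * (\<Sum>t=\<tau>..N. (e t)\<^sup>2)"
    by (simp add: sum_distrib_left power_divide power2_eq_square)
  finally show ?thesis .
qed

lemma mprod_same: "mprod \<Phi> s s = mat 1"
  by (cases s) auto

text \<open>Variation of constants: \<open>x t\<close> is the sum of \<open>mprod \<Phi> s t\<close>
  applied to \<open>e s\<close>, with the initial state counted as the input at
  \<open>\<tau>\<close>; stability makes this a geometric convolution.\<close>

lemma stable_recursion_l2:
  fixes x e :: "nat \<Rightarrow> real^'n" and \<Phi> :: "nat \<Rightarrow> real^'n^'n"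
  assumes \<alpha>: "0 \<le> \<alpha>" "\<alpha> < 1" and L: "1 \<le> L"
    and stable: "\<And>t' t''. \<lbrakk>t' < t''; t'' \<le> N\<rbrakk> \<Longrightarrow> spec_norm (mprod \<Phi> t' t'') \<le> L * \<alpha> ^ (t'' - t')"
    and init: "x \<tau> = e \<tau>"
    and step: "\<And>t. \<lbrakk>\<tau> < t; t \<le> N\<rbrakk> \<Longrightarrow> x t = \<Phi> t *v x (t - 1) + e t"
  shows "(\<Sum>t=\<tau>..N. (norm (x t))\<^sup>2) \<le> (L / (1 - \<alpha>))\<^sup>2 * (\<Sum>t=\<tau>..N. (norm (e t))\<^sup>2)"
proof (rule geometric_convolution_l2)
  fix t assume "t \<in> {\<tau>..N}"
  then have t: "\<tau> \<le> t" "t \<le> N" by auto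
  have "x t = (\<Sum>s=\<tau>..t. mprod \<Phi> s t *v e s)"
    using t
  proof (induction t rule: dec_induct)
    case base
    then show ?case by (simp add: init mprod_same)
  next
    case (step n)
    have "x (Suc n) = \<Phi> (Suc n) *v (\<Sum>s=\<tau>..n. mprod \<Phi> s n *v e s) + e (Suc n)"
      using step assms(6)[of "Suc n"] by simp
    also have "\<Phi> (Suc n) *v (\<Sum>s=\<tau>..n. mprod \<Phi> s n *v e s) = (\<Sum>s=\<tau>..n. mprod \<Phi> s (Suc n) *v e s)"
      by (simp add: linear_sum[OF matrix_vector_mul_linear] matrix_vector_mul_assoc)
    finally show ?case
      using step by (simp add: sum.nat_ivl_Suc')
  qed
  then have "norm (x t) \<le> (\<Sum>s=\<tau>..t. norm (mprod \<Phi> s t *v e s))"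
    by (simp add: norm_sum)
  also have "\<dots> \<le> (\<Sum>s=\<tau>..t. L * \<alpha> ^ (t - s) * norm (e s))"
  proof (rule sum_mono)
    fix s assume s: "s \<in> {\<tau>..t}"
    show "norm (mprod \<Phi> s t *v e s) \<le> L * \<alpha> ^ (t - s) * norm (e s)"
    proof (cases "s = t")
      \<comment> \<open>Stability is assumed only for \<open>t' < t''\<close>; the diagonal term
        carries the identity matrix and is covered by \<open>1 \<le> L\<close>.\<close>
      case True
      then show ?thesis
        using L by (simp add: mprod_same mult_le_cancel_right1)
    next
      case False
      then show ?thesis
        using s t by (intro norm_mult_vec_le stable) auto
    qed
  qed
  finally show "\<bar>norm (x t)\<bar> \<le> (\<Sum>s=\<tau>..t. L * \<alpha> ^ (t - s) * norm (e s))" by simp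
qed (use \<alpha> L in auto)

section \<open>The KKT operator on a scenario tree\<close>

text \<open>Later \<open>Z\<close> is the set of paths through the given prefix,
  \<open>\<pi>\<close> their conditional probability and \<open>N\<close> the last stage of the
  truncated problem. Paths may run beyond \<open>N\<close>, in which case several may share all
  their nodes.\<close>

locale scenario_tree =
  fixes Z :: "'x list set" and \<pi> :: "'x list \<Rightarrow> real" and \<tau> N :: nat
  assumes finite_Z: "finite Z" and \<pi>_pos: "z \<in> Z \<Longrightarrow> 0 < \<pi> z"
    and \<tau>_le: "\<tau> \<le> N" and length_Z: "z \<in> Z \<Longrightarrow> Suc N \<le> length z"
begin

sublocale weighted_l2 "Z \<times> {\<tau>..N}" "\<lambda>(z, t). take (Suc t) z" "\<lambda>(z, t). \<pi> z"
  by unfold_locales (auto intro: finite_Z \<pi>_pos)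

lemma ip_paths: "ip f g = (\<Sum>z\<in>Z. \<pi> z * (\<Sum>t=\<tau>..N. f (take (Suc t) z) \<bullet> g (take (Suc t) z)))"
  unfolding ip_def sum.cartesian_product' by (simp add: sum_distrib_left)

lemma ip_stages: "ip f g = (\<Sum>t=\<tau>..N. \<Sum>z\<in>Z. \<pi> z * (f (take (Suc t) z) \<bullet> g (take (Suc t) z)))"
  unfolding ip_paths sum_distrib_left by (rule sum.swap)

lemma sum_paths_mono:
  "(\<And>z. z \<in> Z \<Longrightarrow> f z \<le> g z) \<Longrightarrow> (\<Sum>z\<in>Z. \<pi> z * f z) \<le> (\<Sum>z\<in>Z. \<pi> z * g z)"
  by (intro sum_mono mult_left_mono) (auto intro: less_imp_le \<pi>_pos)

text \<open>A transition between consecutive stages is counted at its later end on the left and at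
  its earlier end on the right; this moves sums from children to parents.\<close>

lemma shift_stages:
  fixes h :: "nat \<Rightarrow> 'a::comm_monoid_add"
  shows "(\<Sum>t=\<tau>..N. if \<tau> < t then h t else 0) = (\<Sum>t=\<tau>..N. if t < N then h (Suc t) else 0)"
proof -
  have "(\<Sum>t=\<tau>..N. if \<tau> < t then h t else 0) = sum h {t\<in>{\<tau>..N}. \<tau> < t}"
    by (rule sum.inter_filter[symmetric]) simp
  also have "{t\<in>{\<tau>..N}. \<tau> < t} = {Suc \<tau>..<Suc N}" by auto
  also have "sum h {Suc \<tau>..<Suc N} = (\<Sum>t=\<tau>..<N. h (Suc t))"
    by (rule sum.shift_bounds_Suc_ivl)
  also have "{\<tau>..<N} = {t\<in>{\<tau>..N}. t < N}" by auto
  also have "(\<Sum>t\<in>{t\<in>{\<tau>..N}. t < N}. h (Suc t)) = (\<Sum>t=\<tau>..N. if t < N then h (Suc t) else 0)"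
    by (rule sum.inter_filter) simp
  finally show ?thesis .
qed

text \<open>The conditional expectation of \<open>g\<close> at the next stage given the node
  \<open>p\<close>. If no path extends \<open>p\<close>, both sums are empty and the value is
  0.\<close>

definition child_mean :: "('x list \<Rightarrow> 'e::real_vector) \<Rightarrow> 'x list \<Rightarrow> 'e" where
  "child_mean g p = (\<Sum>z\<in>{z\<in>Z. take (length p) z = p}. \<pi> z *\<^sub>R g (take (Suc (length p)) z))
     /\<^sub>R (\<Sum>z\<in>{z\<in>Z. take (length p) z = p}. \<pi> z)"

lemma child_mean_add: "child_mean (\<lambda>c. f c + g c) p = child_mean f p + child_mean g p"
  by (simp add: child_mean_def scaleR_add_right sum.distrib)

lemma child_mean_scale: "child_mean (\<lambda>c. a *\<^sub>R f c) p = a *\<^sub>R child_mean f p"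
  by (simp add: child_mean_def scaleR_sum_right mult_ac)

lemma child_mean_zero:
  "(\<And>z. z \<in> Z \<Longrightarrow> g (take (Suc (length p)) z) = 0) \<Longrightarrow> child_mean g p = 0"
  by (simp add: child_mean_def)

text \<open>Expanding the mean gives a sum over pairs of paths with a common prefix of length
  \<open>n\<close>. The normalizer and the value of \<open>h\<close> depend on that prefix alone, so
  the two paths can exchange roles and the normalizer cancels.\<close>

lemma tower:
  fixes h g :: "'x list \<Rightarrow> 'e::real_inner"
  assumes n: "n \<le> N"
  shows "(\<Sum>z\<in>Z. \<pi> z * (h (take n z) \<bullet> child_mean g (take n z)))
       = (\<Sum>z\<in>Z. \<pi> z * (h (take n z) \<bullet> g (take (Suc n) z)))"
proof -
  define m where "m z = (\<Sum>z'\<in>{z'\<in>Z. take n z' = take n z}. \<pi> z')" for z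
  have m_pos: "0 < m z" if "z \<in> Z" for z
    unfolding m_def using that by (intro sum_pos) (auto intro: \<pi>_pos finite_subset[OF _ finite_Z])
  have len: "length (take n z) = n" if "z \<in> Z" for z
    using length_Z[OF that] n by simp
  have "(\<Sum>z\<in>Z. \<pi> z * (h (take n z) \<bullet> child_mean g (take n z)))
      = (\<Sum>z\<in>Z. \<Sum>z'\<in>{z'\<in>Z. take n z' = take n z}. \<pi> z * \<pi> z' * (h (take n z) \<bullet> g (take (Suc n) z')) / m z)"
    by (rule sum.cong[OF refl])
       (simp add: child_mean_def len m_def[symmetric] inner_sum_right sum_distrib_left sum_divide_distrib
          divide_inverse mult_ac del: length_take)
  also have "\<dots> = (\<Sum>z\<in>Z. \<Sum>z'\<in>Z. if take n z' = take n z
      then \<pi> z * \<pi> z' * (h (take n z') \<bullet> g (take (Suc n) z')) / m z' else 0)"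
    by (rule sum.cong[OF refl], subst sum.inter_filter[OF finite_Z])
       (auto intro!: sum.cong simp: m_def)
  also have "\<dots> = (\<Sum>z'\<in>Z. \<Sum>z\<in>{z\<in>Z. take n z = take n z'}.
      \<pi> z * (\<pi> z' * (h (take n z') \<bullet> g (take (Suc n) z')) / m z'))"
    by (subst sum.swap, rule sum.cong[OF refl], subst sum.inter_filter[OF finite_Z])
       (auto intro!: sum.cong)
  also have "\<dots> = (\<Sum>z'\<in>Z. m z' * (\<pi> z' * (h (take n z') \<bullet> g (take (Suc n) z')) / m z'))"
    by (simp only: m_def sum_distrib_right)
  also have "\<dots> = (\<Sum>z'\<in>Z. \<pi> z' * (h (take n z') \<bullet> g (take (Suc n) z')))"
    using m_pos by (intro sum.cong refl) (simp add: less_imp_neq[symmetric])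
  finally show ?thesis .
qed

lemma node_simps:
  assumes "z \<in> Z" "t \<le> N"
  shows "length (take (Suc t) z) = Suc t" "last (take (Suc t) z) = z ! t"
    "butlast (take (Suc t) z) = take t z"
  using length_Z[OF assms(1)] assms(2) by (simp_all add: take_Suc_conv_app_nth butlast_take)

end

text \<open>\<open>Ks\<close> and \<open>Kd\<close> are witnesses of stabilizability and
  detectability; the almost sure hypotheses are restricted to the paths in \<open>Z\<close> and the
  stages up to \<open>N\<close>.\<close>

locale lq_tree = scenario_tree Z \<pi> \<tau> N
  for Z :: "'x list set" and \<pi> :: "'x list \<Rightarrow> real" and \<tau> N :: nat +
  fixes A :: "'x \<Rightarrow> real^'nx::finite^'nx" and B :: "'x \<Rightarrow> real^'nu::finite^'nx"
    and Q :: "'x \<Rightarrow> real^'nx^'nx" and R :: "'x \<Rightarrow> real^'nu^'nu"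
    and L \<alpha> \<gamma> :: real
    and Ks :: "nat \<Rightarrow> 'x list \<Rightarrow> real^'nx^'nu" and Kd :: "nat \<Rightarrow> 'x list \<Rightarrow> real^'nx^'nx"
  assumes L_ge: "1 \<le> L" and \<alpha>_pos: "0 < \<alpha>" and \<alpha>_lt: "\<alpha> < 1" and \<gamma>_pos: "0 < \<gamma>" and \<gamma>_le: "\<gamma> \<le> 1"
    and Q_sym: "transpose (Q \<xi>) = Q \<xi>" and R_sym: "transpose (R \<xi>) = R \<xi>"
    and bounds: "z \<in> Z \<Longrightarrow> t \<le> N \<Longrightarrow> spec_norm (A (z ! t)) \<le> L \<and> spec_norm (B (z ! t)) \<le> L
      \<and> spec_norm (Q (z ! t)) \<le> L \<and> spec_norm (R (z ! t)) \<le> L"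
    and Q_psd: "z \<in> Z \<Longrightarrow> t \<le> N \<Longrightarrow> 0 \<le> x \<bullet> (Q (z ! t) *v x)"
    and R_pd: "z \<in> Z \<Longrightarrow> t \<le> N \<Longrightarrow> \<gamma> * (u \<bullet> u) \<le> u \<bullet> (R (z ! t) *v u)"
    and Ks_bound: "z \<in> Z \<Longrightarrow> t < N \<Longrightarrow> spec_norm (Ks t (take (Suc t) z)) \<le> L"
    and Ks_stable: "z \<in> Z \<Longrightarrow> t' < t'' \<Longrightarrow> t'' \<le> N \<Longrightarrow>
      spec_norm (mprod (\<lambda>s. A (z ! s) - B (z ! s) ** Ks (s - 1) (take s z)) t' t'') \<le> L * \<alpha> ^ (t'' - t')"
    and Kd_bound: "z \<in> Z \<Longrightarrow> 1 \<le> t \<Longrightarrow> t \<le> N \<Longrightarrow> spec_norm (Kd t (take (Suc t) z)) \<le> L"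
    and Kd_stable: "z \<in> Z \<Longrightarrow> t' < t'' \<Longrightarrow> t'' \<le> N \<Longrightarrow>
      spec_norm (mprod (\<lambda>s. A (z ! s) - Kd s (take (Suc s) z) ** msqrt (Q (z ! (s - 1)))) t' t'')
        \<le> L * \<alpha> ^ (t'' - t')"
begin

definition shift_op :: "('x list \<Rightarrow> (real^'nx) \<times> (real^'nu)) \<Rightarrow> 'x list \<Rightarrow> real^'nx" where
  "shift_op w p = (if Suc \<tau> < length p
     then A (last p) *v fst (w (butlast p)) + B (last p) *v snd (w (butlast p)) else 0)"

text \<open>\<open>l c v* A\<close> is the transpose of \<open>A\<close> applied to
  \<open>l c\<close>. As nodes are weighted by probability, the adjoint averages over the children
  instead of adding them up. The guard \<open>length p \<le> N\<close> excludes stage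
  \<open>N\<close>, which has no successors.\<close>

definition shift_adj :: "('x list \<Rightarrow> real^'nx) \<Rightarrow> 'x list \<Rightarrow> (real^'nx) \<times> (real^'nu)" where
  "shift_adj l p = (if length p \<le> N
     then (child_mean (\<lambda>c. l c v* A (last c)) p, child_mean (\<lambda>c. l c v* B (last c)) p) else 0)"

definition F :: "('x list \<Rightarrow> (real^'nx) \<times> (real^'nu)) \<Rightarrow> 'x list \<Rightarrow> real^'nx" where
  "F w p = fst (w p) - shift_op w p"

definition F_adj :: "('x list \<Rightarrow> real^'nx) \<Rightarrow> 'x list \<Rightarrow> (real^'nx) \<times> (real^'nu)" where
  "F_adj l p = (l p, 0) - shift_adj l p"

definition G :: "('x list \<Rightarrow> (real^'nx) \<times> (real^'nu)) \<Rightarrow> 'x list \<Rightarrow> (real^'nx) \<times> (real^'nu)" where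
  "G w p = (Q (last p) *v fst (w p), R (last p) *v snd (w p))"

definition H :: "('x list \<Rightarrow> ((real^'nx) \<times> (real^'nu)) \<times> (real^'nx))
    \<Rightarrow> 'x list \<Rightarrow> ((real^'nx) \<times> (real^'nu)) \<times> (real^'nx)" where
  "H v p = (G (\<lambda>p. fst (v p)) p + F_adj (\<lambda>p. snd (v p)) p, F (\<lambda>p. fst (v p)) p)"

section \<open>Evaluation at nodes, adjointness and the upper bound\<close>

lemma shift_op_node:
  assumes "z \<in> Z" "t \<le> N"
  shows "shift_op w (take (Suc t) z)
    = (if \<tau> < t then A (z ! t) *v fst (w (take t z)) + B (z ! t) *v snd (w (take t z)) else 0)"
  using assms by (simp add: shift_op_def node_simps del: length_take)

lemma F_node:
  assumes "z \<in> Z" "t \<le> N"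
  shows "F w (take (Suc t) z) = fst (w (take (Suc t) z))
    - (if \<tau> < t then A (z ! t) *v fst (w (take t z)) + B (z ! t) *v snd (w (take t z)) else 0)"
  by (simp add: F_def shift_op_node[OF assms])

lemma ip_shift_op:
  "ip (shift_op w) l = (\<Sum>t=\<tau>..N. if \<tau> < t then (\<Sum>z\<in>Z. \<pi> z *
     ((A (z ! t) *v fst (w (take t z)) + B (z ! t) *v snd (w (take t z))) \<bullet> l (take (Suc t) z))) else 0)"
  unfolding ip_stages
  by (intro sum.cong refl) (auto simp: shift_op_node intro!: sum.cong sum.neutral)

lemma ip_shift_adj: "ip (shift_op w) l = ip w (shift_adj l)"
proof -
  have "ip w (shift_adj l) = (\<Sum>t=\<tau>..N. if t < N then (\<Sum>z\<in>Z. \<pi> z *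
     ((A (z ! Suc t) *v fst (w (take (Suc t) z)) + B (z ! Suc t) *v snd (w (take (Suc t) z)))
       \<bullet> l (take (Suc (Suc t)) z))) else 0)"
    unfolding ip_stages
  proof (intro sum.cong refl)
    fix t assume "t \<in> {\<tau>..N}"
    show "(\<Sum>z\<in>Z. \<pi> z * (w (take (Suc t) z) \<bullet> shift_adj l (take (Suc t) z)))
      = (if t < N then (\<Sum>z\<in>Z. \<pi> z *
     ((A (z ! Suc t) *v fst (w (take (Suc t) z)) + B (z ! Suc t) *v snd (w (take (Suc t) z)))
       \<bullet> l (take (Suc (Suc t)) z))) else 0)"
    proof (cases "t < N")
      case True
      have "(\<Sum>z\<in>Z. \<pi> z * (w (take (Suc t) z) \<bullet> shift_adj l (take (Suc t) z)))
        = (\<Sum>z\<in>Z. \<pi> z * ((\<lambda>p. fst (w p)) (take (Suc t) z)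
              \<bullet> child_mean (\<lambda>c. l c v* A (last c)) (take (Suc t) z)))
        + (\<Sum>z\<in>Z. \<pi> z * ((\<lambda>p. snd (w p)) (take (Suc t) z)
              \<bullet> child_mean (\<lambda>c. l c v* B (last c)) (take (Suc t) z)))"
        unfolding sum.distrib[symmetric]
        using True by (intro sum.cong refl) (simp add: shift_adj_def node_simps inner_prod_def distrib_left del: length_take)
      also have "\<dots> = (\<Sum>z\<in>Z. \<pi> z * (fst (w (take (Suc t) z))
              \<bullet> (l (take (Suc (Suc t)) z) v* A (last (take (Suc (Suc t)) z)))))
        + (\<Sum>z\<in>Z. \<pi> z * (snd (w (take (Suc t) z))
              \<bullet> (l (take (Suc (Suc t)) z) v* B (last (take (Suc (Suc t)) z)))))"
        using True by (subst (1 2) tower) auto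
      also have "\<dots> = (\<Sum>z\<in>Z. \<pi> z *
         ((A (z ! Suc t) *v fst (w (take (Suc t) z)) + B (z ! Suc t) *v snd (w (take (Suc t) z)))
           \<bullet> l (take (Suc (Suc t)) z)))"
        unfolding sum.distrib[symmetric]
        using True by (intro sum.cong refl)
          (simp add: node_simps inner_add_left distrib_left dot_lmul_matrix
             inner_commute[of _ "_ v* _"] inner_commute[of "l _"])
      finally show ?thesis using True by simp
    next
      case False
      then show ?thesis
        using \<open>t \<in> {\<tau>..N}\<close> by (auto simp: shift_adj_def node_simps simp del: length_take intro!: sum.neutral)
    qed
  qed
  then show ?thesis
    unfolding ip_shift_op shift_stages by simp
qed

lemma ip_F: "ip (F w) l = ip (\<lambda>p. fst (w p)) l - ip (shift_op w) l"
  unfolding F_def by (rule ip_diff_left)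

lemma ip_F_adj: "ip (F w) l = ip w (F_adj l)"
proof -
  have "ip w (\<lambda>p. (l p, 0)) = ip (\<lambda>p. fst (w p)) l"
    by (simp add: ip_def inner_prod_def case_prod_beta)
  then show ?thesis
    unfolding ip_F F_adj_def ip_diff_right ip_shift_adj by simp
qed

lemma adj_mult: "x \<bullet> (M *v y) = (M *v x) \<bullet> y" if "transpose M = M" for M :: "real^'n^'n"
  using that by (metis dot_lmul_matrix transpose_matrix_vector)

lemma ip_G_sym: "ip (G w) w' = ip w (G w')"
  by (simp add: ip_def G_def inner_prod_def adj_mult[OF Q_sym] adj_mult[OF R_sym])

lemma ip_pair: "ip v v' = ip (\<lambda>p. fst (v p)) (\<lambda>p. fst (v' p)) + ip (\<lambda>p. snd (v p)) (\<lambda>p. snd (v' p))"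
  by (simp add: ip_def inner_prod_def distrib_left sum.distrib)

lemma ip_H: "ip v (H v') = ip (\<lambda>p. fst (v p)) (G (\<lambda>p. fst (v' p)))
    + ip (F (\<lambda>p. fst (v p))) (\<lambda>p. snd (v' p)) + ip (\<lambda>p. snd (v p)) (F (\<lambda>p. fst (v' p)))"
  unfolding ip_pair[of v] H_def by (simp add: ip_add_right ip_F_adj)

lemma H_selfadjoint: "ip (H v) v' = ip v (H v')"
  unfolding ip_commute[of "H v"] ip_H
  using ip_G_sym[of "\<lambda>p. fst (v' p)" "\<lambda>p. fst (v p)"]
    ip_commute[of "G (\<lambda>p. fst (v' p))" "\<lambda>p. fst (v p)"]
    ip_commute[of "F (\<lambda>p. fst (v' p))" "\<lambda>p. snd (v p)"]
    ip_commute[of "F (\<lambda>p. fst (v p))" "\<lambda>p. snd (v' p)"]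
  by linarith

lemma nrm_G_le: "nrm (G w) \<le> L * nrm w"
proof -
  have "nrm (G w) \<le> nrm (\<lambda>p. L *\<^sub>R w p)"
  proof (rule nrm_mono, clarsimp)
    fix z t assume zt: "z \<in> Z" "\<tau> \<le> t" "t \<le> N"
    let ?p = "take (Suc t) z"
    have "(norm (Q (z ! t) *v fst (w ?p)))\<^sup>2 \<le> (L * norm (fst (w ?p)))\<^sup>2"
      "(norm (R (z ! t) *v snd (w ?p)))\<^sup>2 \<le> (L * norm (snd (w ?p)))\<^sup>2"
      using bounds[OF zt(1,3)] by (auto intro!: power_mono norm_mult_vec_le)
    then have "(norm (G w ?p))\<^sup>2 \<le> (L * norm (w ?p))\<^sup>2"
      using zt by (simp add: G_def node_simps norm_prod_def power_mult_distrib distrib_left)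
    then show "norm (G w ?p) \<le> \<bar>L\<bar> * norm (w ?p)"
      using L_ge by (intro power2_le_imp_le[of "norm (G w ?p)"]) auto
  qed
  then show ?thesis
    using L_ge by (simp add: nrm_scale)
qed

text \<open>On each transition \<open>A\<close> and \<open>B\<close> give one Young inequality each:
  the multiplier at the child is charged twice, each component of the parent once. Along a path a
  node is at most once a child and once a parent.\<close>

lemma shift_form_bound: "2 * \<bar>ip (shift_op w) l\<bar> \<le> L * (2 * ip l l + ip w w)"
proof -
  let ?x = "\<lambda>z t. (norm (w (take t z)))\<^sup>2" and ?l = "\<lambda>z t. (norm (l (take (Suc t) z)))\<^sup>2"
  have pt: "2 * \<bar>(A (z ! t) *v fst (w (take t z)) + B (z ! t) *v snd (w (take t z))) \<bullet> l (take (Suc t) z)\<bar>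
      \<le> L * (2 * ?l z t + ?x z t)" if "z \<in> Z" "t \<le> N" for z t
  proof -
    let ?a = "norm (fst (w (take t z)))" and ?b = "norm (snd (w (take t z)))"
      and ?c = "norm (l (take (Suc t) z))"
    have "norm (A (z ! t) *v fst (w (take t z)) + B (z ! t) *v snd (w (take t z))) \<le> L * ?a + L * ?b"
      using bounds[OF that] by (intro norm_triangle_mono norm_mult_vec_le) auto
    then have "\<bar>(A (z ! t) *v fst (w (take t z)) + B (z ! t) *v snd (w (take t z))) \<bullet> l (take (Suc t) z)\<bar>
        \<le> (L * ?a + L * ?b) * ?c"
      by (intro order_trans[OF Cauchy_Schwarz_ineq2] mult_right_mono) auto
    also have "2 * \<dots> = L * (2 * (?a * ?c) + 2 * (?b * ?c))"
      by (simp add: algebra_simps)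
    also have "\<dots> \<le> L * (2 * ?c\<^sup>2 + (?a\<^sup>2 + ?b\<^sup>2))"
      using sum_squares_bound[of ?a ?c] sum_squares_bound[of ?b ?c] L_ge
      by (intro mult_left_mono) (simp_all add: mult.assoc)
    finally show ?thesis
      by (simp add: norm_prod_def mult_left_mono)
  qed
  have "2 * \<bar>ip (shift_op w) l\<bar> \<le> (\<Sum>t=\<tau>..N. if \<tau> < t then \<Sum>z\<in>Z. \<pi> z * (L * (2 * ?l z t + ?x z t)) else 0)"
  proof -
    have "2 * \<bar>ip (shift_op w) l\<bar> \<le> 2 * (\<Sum>t=\<tau>..N. if \<tau> < t then \<Sum>z\<in>Z. \<pi> z *
       \<bar>(A (z ! t) *v fst (w (take t z)) + B (z ! t) *v snd (w (take t z))) \<bullet> l (take (Suc t) z)\<bar> else 0)"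
      unfolding ip_shift_op
      by (intro mult_left_mono order_trans[OF sum_abs] sum_mono)
         (auto intro!: order_trans[OF sum_abs] sum_mono simp: abs_mult less_imp_le[OF \<pi>_pos])
    also have "\<dots> = (\<Sum>t=\<tau>..N. if \<tau> < t then \<Sum>z\<in>Z. \<pi> z *
       (2 * \<bar>(A (z ! t) *v fst (w (take t z)) + B (z ! t) *v snd (w (take t z))) \<bullet> l (take (Suc t) z)\<bar>) else 0)"
      unfolding sum_distrib_left by (intro sum.cong refl) (simp add: sum_distrib_left mult_ac)
    also have "\<dots> \<le> (\<Sum>t=\<tau>..N. if \<tau> < t then \<Sum>z\<in>Z. \<pi> z * (L * (2 * ?l z t + ?x z t)) else 0)"
    proof (rule sum_mono)
      fix t assume "t \<in> {\<tau>..N}"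
      then show "(if \<tau> < t then \<Sum>z\<in>Z. \<pi> z *
         (2 * \<bar>(A (z ! t) *v fst (w (take t z)) + B (z ! t) *v snd (w (take t z))) \<bullet> l (take (Suc t) z)\<bar>) else 0)
         \<le> (if \<tau> < t then \<Sum>z\<in>Z. \<pi> z * (L * (2 * ?l z t + ?x z t)) else 0)"
        using pt by (auto intro!: sum_paths_mono)
    qed
    finally show ?thesis .
  qed
  also have "\<dots> = L * (2 * (\<Sum>t=\<tau>..N. if \<tau> < t then \<Sum>z\<in>Z. \<pi> z * ?l z t else 0)
      + (\<Sum>t=\<tau>..N. if \<tau> < t then \<Sum>z\<in>Z. \<pi> z * ?x z t else 0))"
    unfolding sum_distrib_left sum.distrib[symmetric]
    by (intro sum.cong refl) (auto simp: sum_distrib_left sum.distrib algebra_simps)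
  also have "(\<Sum>t=\<tau>..N. if \<tau> < t then \<Sum>z\<in>Z. \<pi> z * ?x z t else 0)
      = (\<Sum>t=\<tau>..N. if t < N then \<Sum>z\<in>Z. \<pi> z * ?x z (Suc t) else 0)"
    by (rule shift_stages)
  also have "\<dots> \<le> ip w w"
    unfolding ip_stages power2_norm_eq_inner
    by (intro sum_mono) (auto intro!: sum_nonneg simp: less_imp_le[OF \<pi>_pos])
  also have "(\<Sum>t=\<tau>..N. if \<tau> < t then \<Sum>z\<in>Z. \<pi> z * ?l z t else 0) \<le> ip l l"
    unfolding ip_stages power2_norm_eq_inner
    by (intro sum_mono) (auto intro!: sum_nonneg simp: less_imp_le[OF \<pi>_pos])
  finally show ?thesis
    using L_ge by (simp add: mult_left_mono)
qed

text \<open>The primal part collects \<open>L\<close> from the cost, 1 from the identity in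
  \<open>F\<close> and \<open>L\<close> from the shift; the multiplier collects 1 and
  \<open>2 * L\<close>. Both totals are exactly \<open>2 * L + 1\<close>.\<close>

lemma H_upper: "\<bar>ip v (H v)\<bar> \<le> (2 * L + 1) * ip v v"
proof -
  define w where "w p = fst (v p)" for p
  define l where "l p = snd (v p)" for p
  have "ip v (H v) = ip w (G w) + 2 * ip (F w) l"
    unfolding ip_H by (simp add: w_def[abs_def] l_def[abs_def] ip_commute)
  also have "\<dots> = ip w (G w) + 2 * ip (\<lambda>p. fst (w p)) l - 2 * ip (shift_op w) l"
    by (simp add: ip_F)
  finally have 1: "\<bar>ip v (H v)\<bar> \<le> \<bar>ip w (G w)\<bar> + 2 * \<bar>ip (\<lambda>p. fst (w p)) l\<bar> + 2 * \<bar>ip (shift_op w) l\<bar>"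
    by linarith
  have "\<bar>ip w (G w)\<bar> \<le> nrm w * (L * nrm w)"
    using ip_le_nrm_mult[of w "G w"] mult_left_mono[OF nrm_G_le[of w] nrm_ge_0[of w]] by linarith
  then have 2: "\<bar>ip w (G w)\<bar> \<le> L * ip w w"
    by (simp add: nrm_power2[symmetric] power2_eq_square mult_ac)
  have "nrm (\<lambda>p. fst (w p)) \<le> nrm w"
    by (rule nrm_mono) (metis norm_fst_le prod.collapse)
  then have "\<bar>ip (\<lambda>p. fst (w p)) l\<bar> \<le> nrm w * nrm l"
    using ip_le_nrm_mult[of "\<lambda>p. fst (w p)" l] mult_right_mono[OF _ nrm_ge_0[of l]] order_trans by blast
  then have 3: "2 * \<bar>ip (\<lambda>p. fst (w p)) l\<bar> \<le> ip w w + ip l l"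
    using sum_squares_bound[of "nrm w" "nrm l"] by (simp add: nrm_power2)
  have "ip v v = ip w w + ip l l"
    unfolding ip_pair[of v] w_def l_def ..
  then show ?thesis
    using 1 2 3 shift_form_bound[of w l] by (simp add: algebra_simps)
qed

lemma H_linear: "pointwise_linear H"
  unfolding pointwise_linear_def
proof (intro conjI allI ext)
  show "H (\<lambda>p. f p + g p) p = H f p + H g p" for f g p
    by (simp add: H_def G_def F_def F_adj_def shift_op_def shift_adj_def child_mean_add
        matrix_vector_right_distrib vector_matrix_left_distrib algebra_simps zero_prod_def)
  show "H (\<lambda>p. c *\<^sub>R f p) p = c *\<^sub>R H f p" for c f p
    by (simp add: H_def G_def F_def F_adj_def shift_op_def shift_adj_def child_mean_scale
        matrix_vector_mult_scaleR scaleR_vector_matrix_assoc algebra_simps zero_prod_def)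
qed

lemma H_banded:
  assumes f: "\<And>p. length p - 1 \<in> S \<Longrightarrow> f p = 0"
    and S: "{length p - 1 - 1, length p - 1, length p - 1 + 1} \<subseteq> S"
  shows "H f p = 0"
proof -
  have "f p = 0" using f S by simp
  moreover have "f (butlast p) = 0" using S by (intro f) auto
  \<comment> \<open>For \<open>p = []\<close> truncated subtraction puts \<open>p\<close> and its
    one-entry children on the common level 0, hence the case split.\<close>
  moreover have "f (take (Suc (length p)) z) = 0" if "z \<in> Z" "length p \<le> N" for z
    using S length_Z[OF that(1)] that(2) by (intro f) (cases p, auto)
  ultimately have "shift_op (\<lambda>p. fst (f p)) p = 0" "shift_adj (\<lambda>p. snd (f p)) p = 0"
    by (auto simp: shift_op_def shift_adj_def zero_prod_def intro!: child_mean_zero)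
  with \<open>f p = 0\<close> show ?thesis
    by (simp add: H_def G_def F_def F_adj_def zero_prod_def)
qed

end

section \<open>Spectral bounds for the KKT operator\<close>

context lq_tree
begin

text \<open>Norm bound for a right inverse of \<open>F\<close>: \<open>L / (1 - \<alpha>)\<close>
  for the states and \<open>1 + L\<close> for adjoining the feedback control. Its inverse square is
  \<open>gamma_F\<close>.\<close>

definition C_F :: real where "C_F = (1 + L) * L / (1 - \<alpha>)"

lemma C_F_ge: "2 \<le> C_F"
proof -
  have "2 * (1 - \<alpha>) \<le> 2 * 1" using \<alpha>_pos by simp
  also have "2 * 1 \<le> (1 + L) * L" using L_ge by (intro mult_mono) auto
  finally show ?thesis using \<alpha>_lt by (simp add: C_F_def field_simps)
qed

text \<open>The state at stage \<open>\<tau> + k\<close> under the stabilizing gains, with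
  \<open>b\<close> as disturbance. It reads only a prefix of its list argument and so gives a
  nonanticipative policy.\<close>

primrec closed_loop :: "('x list \<Rightarrow> real^'nx) \<Rightarrow> nat \<Rightarrow> 'x list \<Rightarrow> real^'nx" where
  "closed_loop b 0 p = b (take (Suc \<tau>) p)"
| "closed_loop b (Suc k) p =
    (A (p ! (\<tau> + Suc k)) - B (p ! (\<tau> + Suc k)) ** Ks (\<tau> + k) (take (\<tau> + Suc k) p)) *v closed_loop b k p
    + b (take (Suc (\<tau> + Suc k)) p)"

lemma closed_loop_take: "Suc (\<tau> + k) \<le> n \<Longrightarrow> closed_loop b k (take n p) = closed_loop b k p"
  by (induction k) (simp_all add: min_def)

text \<open>The control at stage \<open>N\<close> is 0: no later state depends on it, and the gain
  is bounded only before that stage.\<close>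

definition feedback :: "('x list \<Rightarrow> real^'nx) \<Rightarrow> 'x list \<Rightarrow> (real^'nx) \<times> (real^'nu)" where
  "feedback b p = (let x = closed_loop b (length p - Suc \<tau>) p
     in (x, if length p \<le> N then - (Ks (length p - 1) p *v x) else 0))"

lemma feedback_node:
  assumes "z \<in> Z" "\<tau> \<le> t" "t \<le> N"
  shows "fst (feedback b (take (Suc t) z)) = closed_loop b (t - \<tau>) z"
    "snd (feedback b (take (Suc t) z))
      = (if t < N then - (Ks t (take (Suc t) z) *v closed_loop b (t - \<tau>) z) else 0)"
  using assms by (auto simp: feedback_def Let_def node_simps closed_loop_take simp del: length_take)

lemma closed_loop_step:
  assumes "\<tau> < t"
  shows "closed_loop b (t - \<tau>) z
    = (A (z ! t) - B (z ! t) ** Ks (t - 1) (take t z)) *v closed_loop b (t - 1 - \<tau>) z + b (take (Suc t) z)"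
proof -
  obtain k where "t = \<tau> + Suc k"
    using assms less_imp_Suc_add by force
  then show ?thesis by simp
qed

lemma F_feedback:
  assumes z: "z \<in> Z" and t: "\<tau> \<le> t" "t \<le> N"
  shows "F (feedback b) (take (Suc t) z) = b (take (Suc t) z)"
proof (cases "t = \<tau>")
  case True
  then show ?thesis
    using z t by (simp add: F_node feedback_node)
next
  case False
  then obtain k where k: "t = Suc k" "\<tau> \<le> k"
    using t by (cases t) auto
  have "F (feedback b) (take (Suc t) z) = closed_loop b (t - \<tau>) z
      - (A (z ! t) *v fst (feedback b (take (Suc k) z)) + B (z ! t) *v snd (feedback b (take (Suc k) z)))"
    using k feedback_node(1)[OF z t, of b] F_node[OF z t(2), of "feedback b"]
    by (simp del: closed_loop.simps)
  also have "\<dots> = b (take (Suc t) z)"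
    using k t closed_loop_step[of t b z] z
    by (simp add: feedback_node[OF z k(2)] matrix_vector_mult_diff_rdistrib
        matrix_vector_mul_assoc[symmetric] linear_neg[OF matrix_vector_mul_linear] del: closed_loop.simps)
  finally show ?thesis .
qed

lemma nrm_feedback: "nrm (feedback b) \<le> C_F * nrm b"
proof -
  have path: "(\<Sum>t=\<tau>..N. feedback b (take (Suc t) z) \<bullet> feedback b (take (Suc t) z))
      \<le> C_F\<^sup>2 * (\<Sum>t=\<tau>..N. b (take (Suc t) z) \<bullet> b (take (Suc t) z))" if z: "z \<in> Z" for z
  proof -
    let ?x = "\<lambda>t. closed_loop b (t - \<tau>) z"
    have "(\<Sum>t=\<tau>..N. feedback b (take (Suc t) z) \<bullet> feedback b (take (Suc t) z))
        \<le> (\<Sum>t=\<tau>..N. (1 + L)\<^sup>2 * (norm (?x t))\<^sup>2)"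
    proof (rule sum_mono)
      fix t assume "t \<in> {\<tau>..N}"
      then have t: "\<tau> \<le> t" "t \<le> N" by auto
      have "norm (snd (feedback b (take (Suc t) z))) \<le> L * norm (?x t)"
        using L_ge by (auto simp: feedback_node[OF z t] intro!: norm_mult_vec_le Ks_bound[OF z])
      then have "(norm (snd (feedback b (take (Suc t) z))))\<^sup>2 \<le> L\<^sup>2 * (norm (?x t))\<^sup>2"
        unfolding power_mult_distrib[symmetric] by (rule power_mono) simp
      then have "feedback b (take (Suc t) z) \<bullet> feedback b (take (Suc t) z) \<le> (1 + L\<^sup>2) * (norm (?x t))\<^sup>2"
        by (simp add: inner_prod_def power2_norm_eq_inner[symmetric] feedback_node(1)[OF z t] algebra_simps)
      also have "\<dots> \<le> (1 + L)\<^sup>2 * (norm (?x t))\<^sup>2"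
        using L_ge by (intro mult_right_mono) (simp_all add: power2_sum)
      finally show "feedback b (take (Suc t) z) \<bullet> feedback b (take (Suc t) z) \<le> (1 + L)\<^sup>2 * (norm (?x t))\<^sup>2" .
    qed
    also have "\<dots> = (1 + L)\<^sup>2 * (\<Sum>t=\<tau>..N. (norm (?x t))\<^sup>2)"
      by (simp add: sum_distrib_left)
    also have "\<dots> \<le> (1 + L)\<^sup>2 * ((L / (1 - \<alpha>))\<^sup>2 * (\<Sum>t=\<tau>..N. (norm (b (take (Suc t) z)))\<^sup>2))"
    proof (rule mult_left_mono[OF stable_recursion_l2])
      show "spec_norm (mprod (\<lambda>s. A (z ! s) - B (z ! s) ** Ks (s - 1) (take s z)) t' t'') \<le> L * \<alpha> ^ (t'' - t')"
        if "t' < t''" "t'' \<le> N" for t' t''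
        using Ks_stable[OF z that] .
      show "closed_loop b (t - \<tau>) z = (A (z ! t) - B (z ! t) ** Ks (t - 1) (take t z))
          *v closed_loop b (t - 1 - \<tau>) z + b (take (Suc t) z)" if "\<tau> < t" for t
        using closed_loop_step[OF that] .
    qed (use \<alpha>_pos \<alpha>_lt L_ge in auto)
    also have "\<dots> = C_F\<^sup>2 * (\<Sum>t=\<tau>..N. b (take (Suc t) z) \<bullet> b (take (Suc t) z))"
      by (simp add: C_F_def power_mult_distrib power_divide power2_norm_eq_inner)
    finally show ?thesis .
  qed
  have "ip (feedback b) (feedback b) \<le> (\<Sum>z\<in>Z. \<pi> z * (C_F\<^sup>2 * (\<Sum>t=\<tau>..N. b (take (Suc t) z) \<bullet> b (take (Suc t) z))))"
    unfolding ip_paths by (intro sum_paths_mono path)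
  also have "\<dots> = C_F\<^sup>2 * ip b b"
    by (simp add: ip_paths sum_distrib_left mult_ac)
  finally have "(nrm (feedback b))\<^sup>2 \<le> (C_F * nrm b)\<^sup>2"
    by (simp add: nrm_power2 power_mult_distrib)
  then show ?thesis
    by (rule power2_le_imp_le) (use C_F_ge in simp)
qed

section \<open>Coercivity of the cost on the kernel of the constraints\<close>

definition g\<^sub>G :: real where "g\<^sub>G = gamma_G L \<alpha> \<gamma>"

lemma g\<^sub>G_pos: "0 < g\<^sub>G"
  using L_ge \<alpha>_lt \<gamma>_pos by (simp add: g\<^sub>G_def gamma_G_def)

text \<open>The coercivity argument yields the constant
  \<open>\<gamma> / (2 * L^4 / (1 - \<alpha>)^2 + 1)\<close>; \<open>gamma_G\<close> lies below it
  because \<open>2 * L^4 + (1 - \<alpha>)^2 \<le> 8 * L^4\<close> and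
  \<open>4 \<le> (1 + L)^2\<close>.\<close>

lemma g\<^sub>G_le: "g\<^sub>G * (2 * L^4 / (1 - \<alpha>)\<^sup>2 + 1) \<le> \<gamma>"
proof -
  have a: "0 < (1 - \<alpha>)\<^sup>2" "(1 - \<alpha>)\<^sup>2 \<le> 1"
    using \<alpha>_pos \<alpha>_lt by (auto simp: power_le_one)
  have L4: "1 \<le> L^4" using L_ge by simp
  have L2: "2\<^sup>2 \<le> (1 + L)\<^sup>2" using L_ge by (intro power_mono) auto
  have "2 * L^4 + (1 - \<alpha>)\<^sup>2 \<le> 2 * (4 * L^4)" using a L4 by simp
  also have "\<dots> \<le> 2 * ((1 + L)\<^sup>2 * L^4)" using L2 L4 by (intro mult_left_mono mult_right_mono) auto
  finally have *: "2 * L^4 + (1 - \<alpha>)\<^sup>2 \<le> 2 * (1 + L)\<^sup>2 * L^4" by simp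
  have "g\<^sub>G * (2 * L^4 / (1 - \<alpha>)\<^sup>2 + 1) = \<gamma> * ((2 * L^4 + (1 - \<alpha>)\<^sup>2) / (2 * (1 + L)\<^sup>2 * L^4))"
  proof -
    have "\<gamma> * D / X * (Y / D + 1) = \<gamma> * ((Y + D) / X)" if "0 < D" for D X Y :: real
    proof -
      have "Y / D + 1 = (Y + D) / D" using that by (simp add: add_divide_distrib)
      then show ?thesis using that by simp
    qed
    from this[OF a(1)] show ?thesis
      by (simp add: g\<^sub>G_def gamma_G_def)
  qed
  also have "\<dots> \<le> \<gamma> * 1"
    using * L4 L_ge \<gamma>_pos by (intro mult_left_mono) (auto simp: divide_le_eq_1)
  finally show ?thesis by simp
qed

text \<open>On the kernel of \<open>F\<close> the states start at 0 and obey the homogeneous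
  dynamics. Output injection rewrites these as a stable recursion driven by the root of
  \<open>Q\<close> applied to the state and by the control, which are exactly the quantities the
  cost controls.\<close>

lemma G_coercive:
  assumes w: "\<And>z t. \<lbrakk>z \<in> Z; \<tau> \<le> t; t \<le> N\<rbrakk> \<Longrightarrow> F w (take (Suc t) z) = 0"
  shows "g\<^sub>G * ip w w \<le> ip w (G w)"
proof -
  have path: "g\<^sub>G * (\<Sum>t=\<tau>..N. w (take (Suc t) z) \<bullet> w (take (Suc t) z))
      \<le> (\<Sum>t=\<tau>..N. w (take (Suc t) z) \<bullet> G w (take (Suc t) z))" if z: "z \<in> Z" for z
  proof -
    define x where "x t = fst (w (take (Suc t) z))" for t
    define u where "u t = snd (w (take (Suc t) z))" for t
    define C where "C t = msqrt (Q (z ! t))" for t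
    define y where "y t = (norm (C t *v x t))\<^sup>2 + (norm (u t))\<^sup>2" for t
    \<comment> \<open>The input left after \<open>Kd\<close> times \<open>C\<close> times the state
      is subtracted from and added to the dynamics; it is 0 at \<open>\<tau>\<close>, where
      \<open>F w = 0\<close> forces \<open>x \<tau> = 0\<close>.\<close>
    define e where "e t = (if \<tau> < t then Kd t (take (Suc t) z) *v (C (t - 1) *v x (t - 1))
        + B (z ! t) *v u (t - 1) else 0)" for t
    have y0: "0 \<le> y t" for t by (simp add: y_def)
    have psdQ: "psd (Q (z ! t))" if "t \<le> N" for t
      using Q_psd[OF z that] Q_sym by (simp add: psd_def)
    have dyn: "x t = (if \<tau> < t then A (z ! t) *v x (t - 1) + B (z ! t) *v u (t - 1) else 0)"
      if "\<tau> \<le> t" "t \<le> N" for t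
      using w[OF z that] F_node[OF z that(2), of w] by (auto simp: x_def u_def split: if_splits)
    have "(\<Sum>t=\<tau>..N. (norm (x t))\<^sup>2) \<le> (L / (1 - \<alpha>))\<^sup>2 * (\<Sum>t=\<tau>..N. (norm (e t))\<^sup>2)"
    proof (rule stable_recursion_l2)
      show "spec_norm (mprod (\<lambda>s. A (z ! s) - Kd s (take (Suc s) z) ** C (s - 1)) t' t'') \<le> L * \<alpha> ^ (t'' - t')"
        if "t' < t''" "t'' \<le> N" for t' t''
        using Kd_stable[OF z that] unfolding C_def .
      show "x \<tau> = e \<tau>"
        using dyn[of \<tau>] \<tau>_le by (simp add: e_def)
      show "x t = (A (z ! t) - Kd t (take (Suc t) z) ** C (t - 1)) *v x (t - 1) + e t"
        if "\<tau> < t" "t \<le> N" for t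
        using dyn[of t] that
        by (simp add: e_def matrix_vector_mult_diff_rdistrib matrix_vector_mul_assoc[symmetric])
    qed (use \<alpha>_pos \<alpha>_lt L_ge in auto)
    also have "(\<Sum>t=\<tau>..N. (norm (e t))\<^sup>2) \<le> (\<Sum>t=\<tau>..N. if \<tau> < t then 2 * L\<^sup>2 * y (t - 1) else 0)"
    proof (rule sum_mono)
      fix t assume t: "t \<in> {\<tau>..N}"
      show "(norm (e t))\<^sup>2 \<le> (if \<tau> < t then 2 * L\<^sup>2 * y (t - 1) else 0)"
      proof (cases "\<tau> < t")
        case True
        let ?a = "norm (C (t - 1) *v x (t - 1))" and ?b = "norm (u (t - 1))"
        have "norm (e t) \<le> L * ?a + L * ?b"
          using True t z bounds[OF z, of t] Kd_bound[OF z, of t]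
          by (auto simp: e_def intro!: norm_triangle_mono norm_mult_vec_le)
        then have "(norm (e t))\<^sup>2 \<le> (L * ?a + L * ?b)\<^sup>2"
          by (rule power_mono) simp
        also have "\<dots> = L\<^sup>2 * (?a + ?b)\<^sup>2"
          by (simp add: power_mult_distrib[symmetric] distrib_left)
        also have "\<dots> \<le> L\<^sup>2 * (2 * (?a\<^sup>2 + ?b\<^sup>2))"
          using sum_squares_bound[of ?a ?b] by (intro mult_left_mono) (simp_all add: power2_sum)
        finally show ?thesis using True by (simp add: y_def distrib_left mult_ac)
      qed (simp add: e_def)
    qed
    also have "\<dots> = (\<Sum>t=\<tau>..N. if t < N then 2 * L\<^sup>2 * y t else 0)"
      using shift_stages[of "\<lambda>t. 2 * L\<^sup>2 * y (t - 1)"] unfolding diff_Suc_1 .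
    also have "\<dots> \<le> (\<Sum>t=\<tau>..N. 2 * L\<^sup>2 * y t)"
      by (intro sum_mono) (simp add: y0)
    finally have "(\<Sum>t=\<tau>..N. (norm (x t))\<^sup>2) \<le> (L / (1 - \<alpha>))\<^sup>2 * (\<Sum>t=\<tau>..N. 2 * L\<^sup>2 * y t)"
      by (simp add: mult_left_mono)
    also have "\<dots> = 2 * L^4 / (1 - \<alpha>)\<^sup>2 * (\<Sum>t=\<tau>..N. y t)"
      by (simp add: sum_distrib_left[symmetric] power_divide power4_eq_xxxx power2_eq_square)
    finally have X: "(\<Sum>t=\<tau>..N. (norm (x t))\<^sup>2) \<le> 2 * L^4 / (1 - \<alpha>)\<^sup>2 * (\<Sum>t=\<tau>..N. y t)" .
    have U: "(\<Sum>t=\<tau>..N. (norm (u t))\<^sup>2) \<le> (\<Sum>t=\<tau>..N. y t)"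
      by (intro sum_mono) (simp add: y_def)
    have "(\<Sum>t=\<tau>..N. w (take (Suc t) z) \<bullet> w (take (Suc t) z))
        = (\<Sum>t=\<tau>..N. (norm (x t))\<^sup>2) + (\<Sum>t=\<tau>..N. (norm (u t))\<^sup>2)"
      by (simp add: x_def u_def inner_prod_def power2_norm_eq_inner sum.distrib)
    also have "\<dots> \<le> (2 * L^4 / (1 - \<alpha>)\<^sup>2 + 1) * (\<Sum>t=\<tau>..N. y t)"
      using X U by (simp add: distrib_right)
    finally have "g\<^sub>G * (\<Sum>t=\<tau>..N. w (take (Suc t) z) \<bullet> w (take (Suc t) z))
        \<le> g\<^sub>G * ((2 * L^4 / (1 - \<alpha>)\<^sup>2 + 1) * (\<Sum>t=\<tau>..N. y t))"
      using g\<^sub>G_pos by (intro mult_left_mono) auto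
    also have "\<dots> \<le> \<gamma> * (\<Sum>t=\<tau>..N. y t)"
      unfolding mult.assoc[symmetric] by (intro mult_right_mono g\<^sub>G_le sum_nonneg y0)
    also have "\<dots> = (\<Sum>t=\<tau>..N. \<gamma> * y t)"
      by (rule sum_distrib_left)
    also have "\<dots> \<le> (\<Sum>t=\<tau>..N. w (take (Suc t) z) \<bullet> G w (take (Suc t) z))"
    proof (rule sum_mono)
      fix t assume "t \<in> {\<tau>..N}"
      then have t: "t \<le> N" by simp
      \<comment> \<open>\<open>\<gamma> \<le> 1\<close> lets the state term share the constant of
        the control term.\<close>
      have "\<gamma> * (norm (C t *v x t))\<^sup>2 \<le> 1 * (norm (C t *v x t))\<^sup>2"
        using \<gamma>_le by (intro mult_right_mono) auto
      also have "\<dots> = x t \<bullet> (Q (z ! t) *v x t)"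
        unfolding C_def by (simp add: norm_msqrt[OF psdQ[OF t]])
      finally have "\<gamma> * (norm (C t *v x t))\<^sup>2 \<le> x t \<bullet> (Q (z ! t) *v x t)" .
      moreover have "\<gamma> * (norm (u t))\<^sup>2 \<le> u t \<bullet> (R (z ! t) *v u t)"
        using R_pd[OF z t] by (simp add: power2_norm_eq_inner)
      ultimately show "\<gamma> * y t \<le> w (take (Suc t) z) \<bullet> G w (take (Suc t) z)"
        using z t by (simp add: y_def distrib_left G_def inner_prod_def node_simps x_def u_def del: length_take)
    qed
    finally show ?thesis .
  qed
  have "g\<^sub>G * ip w w = (\<Sum>z\<in>Z. \<pi> z * (g\<^sub>G * (\<Sum>t=\<tau>..N. w (take (Suc t) z) \<bullet> w (take (Suc t) z))))"
    by (simp add: ip_paths sum_distrib_left mult_ac)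
  also have "\<dots> \<le> ip w (G w)"
    unfolding ip_paths by (intro sum_paths_mono path)
  finally show ?thesis .
qed

text \<open>A saddle-point estimate: \<open>w1\<close> is a feedback policy with the same image
  under \<open>F\<close> as \<open>w\<close>, and the rest \<open>w0\<close> lies in the kernel of
  \<open>F\<close>, where the multiplier drops out and \<open>G\<close> is coercive.\<close>

lemma nrm_le_nrm_H:
  "nrm v \<le> (2 * C_F + C_F\<^sup>2 * L + (1 + C_F * L)\<^sup>2 / g\<^sub>G) * nrm (H v)"
proof -
  define w where "w p = fst (v p)" for p
  define l where "l p = snd (v p)" for p
  define b where "b p = fst (H v p)" for p
  define c where "c p = snd (H v p)" for p
  let ?\<beta> = "nrm (H v)"
  have b: "b = (\<lambda>p. G w p + F_adj l p)" and c: "c = F w"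
    by (auto simp: b_def c_def H_def w_def[abs_def] l_def[abs_def])
  have nb: "nrm b \<le> ?\<beta>"
    by (rule nrm_mono) (metis b_def norm_fst_le prod.collapse)
  have nc: "nrm c \<le> ?\<beta>"
    by (rule nrm_mono) (metis c_def norm_snd_le prod.collapse)
  have "0 \<le> ?\<beta>" "0 \<le> C_F" using C_F_ge by auto
  have weak: "ip w' b = ip w' (G w) + ip (F w') l" for w'
    by (simp add: b ip_add_right ip_F_adj)

  define w1 where "w1 = feedback c"
  define w0 where "w0 p = w p - w1 p" for p
  have n1: "nrm w1 \<le> C_F * ?\<beta>"
    unfolding w1_def using nrm_feedback[of c] mult_left_mono[OF nc \<open>0 \<le> C_F\<close>] by linarith
  have F0: "F w0 (take (Suc t) z) = 0" if "z \<in> Z" "\<tau> \<le> t" "t \<le> N" for z t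
  proof -
    have "F w0 p = F w p - F w1 p" for p
      by (simp add: F_def shift_op_def w0_def matrix_vector_mult_diff_distrib)
    then show ?thesis
      using F_feedback[OF that, of c] by (simp add: w1_def c)
  qed
  have "ip (F w0) l = 0"
    using F0 by (auto simp: ip_def intro!: sum.neutral)
  then have "ip w0 b = ip w0 (G w)"
    by (simp add: weak)
  moreover have "G w = (\<lambda>p. G w0 p + G w1 p)"
    by (auto simp: G_def w0_def matrix_vector_right_distrib[symmetric])
  ultimately have "ip w0 (G w0) = ip w0 b - ip w0 (G w1)"
    by (simp add: ip_add_right)
  then have "g\<^sub>G * (nrm w0)\<^sup>2 \<le> ip w0 b - ip w0 (G w1)"
    using G_coercive[OF F0] by (simp add: nrm_power2)
  also have "\<dots> \<le> nrm w0 * nrm b + nrm w0 * nrm (G w1)"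
    using ip_le_nrm_mult[of w0 b] ip_le_nrm_mult[of w0 "G w1"] by linarith
  also have "\<dots> = nrm w0 * (nrm b + nrm (G w1))"
    by (simp add: distrib_left)
  also have "\<dots> \<le> nrm w0 * (?\<beta> + L * (C_F * ?\<beta>))"
    using nb order_trans[OF nrm_G_le mult_left_mono[OF n1, of L]] L_ge
    by (intro mult_left_mono add_mono) auto
  finally have "nrm w0 * (g\<^sub>G * nrm w0) \<le> nrm w0 * (?\<beta> + L * (C_F * ?\<beta>))"
    by (simp add: power2_eq_square mult_ac)
  then have "g\<^sub>G * nrm w0 \<le> ?\<beta> + L * (C_F * ?\<beta>)"
    using \<open>0 \<le> ?\<beta>\<close> \<open>0 \<le> C_F\<close> L_ge by (cases "nrm w0 = 0") (auto simp: mult_le_cancel_left less_le)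
  then have n0: "nrm w0 \<le> (1 + C_F * L) * ?\<beta> / g\<^sub>G"
    using g\<^sub>G_pos by (simp add: field_simps)
  have "nrm w \<le> nrm w0 + nrm w1"
    using nrm_triangle[of w0 w1] by (simp add: w0_def)
  then have nw: "nrm w \<le> (C_F + (1 + C_F * L) / g\<^sub>G) * ?\<beta>"
    using n0 n1 by (simp add: distrib_right)

  \<comment> \<open>Testing the first block equation with a policy whose image under
    \<open>F\<close> is \<open>l\<close> itself isolates \<open>nrm l\<close>.\<close>
  define w2 where "w2 = feedback l"
  have "ip (F w2) l = ip l l"
    by (rule ip_cong) (auto simp: w2_def F_feedback)
  then have "(nrm l)\<^sup>2 = ip w2 b - ip w2 (G w)"
    by (simp add: weak nrm_power2)
  also have "\<dots> \<le> nrm w2 * nrm b + nrm w2 * nrm (G w)"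
    using ip_le_nrm_mult[of w2 b] ip_le_nrm_mult[of w2 "G w"] by linarith
  also have "\<dots> = nrm w2 * (nrm b + nrm (G w))"
    by (simp add: distrib_left)
  also have "\<dots> \<le> (C_F * nrm l) * (?\<beta> + L * nrm w)"
    using nrm_feedback[of l] nb nrm_G_le[of w] \<open>0 \<le> C_F\<close>
    by (intro mult_mono add_mono) (auto simp: w2_def)
  finally have "nrm l * nrm l \<le> nrm l * (C_F * (?\<beta> + L * nrm w))"
    by (simp add: power2_eq_square mult_ac)
  then have "nrm l \<le> C_F * (?\<beta> + L * nrm w)"
    using \<open>0 \<le> ?\<beta>\<close> \<open>0 \<le> C_F\<close> L_ge by (cases "nrm l = 0") (auto simp: mult_le_cancel_left less_le)
  also have "\<dots> \<le> C_F * (?\<beta> + L * ((C_F + (1 + C_F * L) / g\<^sub>G) * ?\<beta>))"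
    using nw \<open>0 \<le> C_F\<close> L_ge by (intro mult_left_mono add_left_mono) auto
  finally have nl: "nrm l \<le> C_F * (?\<beta> + L * ((C_F + (1 + C_F * L) / g\<^sub>G) * ?\<beta>))" .
  have "(nrm v)\<^sup>2 = (nrm w)\<^sup>2 + (nrm l)\<^sup>2"
    unfolding nrm_power2 ip_pair[of v] w_def l_def ..
  also have "\<dots> \<le> (nrm w + nrm l)\<^sup>2"
    by (simp add: power2_sum)
  finally have "nrm v \<le> nrm w + nrm l"
    by (rule power2_le_imp_le) simp
  also have "\<dots> \<le> (C_F + (1 + C_F * L) / g\<^sub>G) * ?\<beta> + C_F * (?\<beta> + L * ((C_F + (1 + C_F * L) / g\<^sub>G) * ?\<beta>))"
    using nw nl by linarith
  \<comment> \<open>The terms \<open>(1 + C_F * L) / g\<^sub>G\<close> from \<open>w\<close> and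
    \<open>C_F * L\<close> times the same from \<open>l\<close> combine to the square.\<close>
  also have "\<dots> = (2 * C_F + C_F\<^sup>2 * L + (1 + C_F * L)\<^sup>2 / g\<^sub>G) * ?\<beta>"
    using g\<^sub>G_pos by (simp add: field_simps power2_eq_square)
  finally show ?thesis .
qed

section \<open>Comparison with the explicit constants\<close>

lemma gamma_F_eq: "gamma_F L \<alpha> = 1 / C_F\<^sup>2"
  by (simp add: gamma_F_def C_F_def power_mult_distrib power_divide)

definition \<sigma>\<^sub>H :: real where "\<sigma>\<^sub>H = gamma_H L \<alpha> \<gamma>"

text \<open>As \<open>1 + \<mu> * l\<close> is at least 1, \<open>K\<close> dominates
  \<open>l * C_F^2\<close>. One copy of \<open>K\<close> then absorbs
  \<open>2 * C_F + C_F^2 * L\<close>, while \<open>P1\<close> and \<open>2 / g\<^sub>G\<close>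
  absorb the squared term. The second bound serves to place \<sigma> between 0 and 1.\<close>

lemma inverse_\<sigma>\<^sub>H:
  "2 * C_F + C_F\<^sup>2 * L + (1 + C_F * L)\<^sup>2 / g\<^sub>G \<le> inverse \<sigma>\<^sub>H" "2 / g\<^sub>G \<le> inverse \<sigma>\<^sub>H"
proof -
  define l where "l = L_H L"
  define \<mu> where "\<mu> = mu_bar L \<alpha> \<gamma>"
  define K where "K = l * (1 + \<mu> * l) / gamma_F L \<alpha>"
  define P where "P = (1 + 4 * l / g\<^sub>G + 4 * l\<^sup>2 / g\<^sub>G\<^sup>2) * K"
  define P1 where "P1 = 4 * l / g\<^sub>G * K"
  have l: "l = 2 * L + 1" by (simp add: l_def L_H_def)
  have C: "0 < C_F" "2 \<le> C_F" using C_F_ge by auto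
  have \<mu>: "0 \<le> \<mu>"
    using g\<^sub>G_pos L_ge C by (simp add: \<mu>_def mu_bar_def gamma_F_eq g\<^sub>G_def[symmetric] L_H_def)
  have inv: "inverse \<sigma>\<^sub>H = 2 / g\<^sub>G + P + \<mu>"
    by (simp add: P_def \<sigma>\<^sub>H_def gamma_H_def g\<^sub>G_def l_def \<mu>_def K_def)
  have "l * C_F\<^sup>2 * 1 \<le> l * C_F\<^sup>2 * (1 + \<mu> * l)"
    using \<mu> L_ge by (intro mult_left_mono) (auto simp: l)
  then have K: "l * C_F\<^sup>2 \<le> K"
    by (simp add: K_def gamma_F_eq mult_ac)
  then have K0: "0 \<le> K"
    using L_ge C by (intro order_trans[OF _ K]) (auto simp: l)
  have "1 * K + 4 * l / g\<^sub>G * K + 0 \<le> 1 * K + 4 * l / g\<^sub>G * K + 4 * l\<^sup>2 / g\<^sub>G\<^sup>2 * K"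
    using K0 by (intro add_left_mono) auto
  then have 1: "K + P1 \<le> P"
    by (simp add: P_def P1_def distrib_right)
  have "2 * C_F + C_F\<^sup>2 * L \<le> C_F * C_F + C_F\<^sup>2 * L"
    using C by (intro add_right_mono mult_right_mono) auto
  also have "\<dots> = C_F\<^sup>2 * (1 + L)" by (simp add: power2_eq_square distrib_left)
  also have "\<dots> \<le> C_F\<^sup>2 * l" using L_ge by (intro mult_left_mono) (auto simp: l)
  finally have 2: "2 * C_F + C_F\<^sup>2 * L \<le> K" using K by (simp add: mult_ac)
  have "1 * C_F * L \<le> C_F * C_F * L"
    using C L_ge by (intro mult_right_mono) auto
  then have "2 * (C_F * L) \<le> 2 * (C_F\<^sup>2 * L)"
    by (simp add: power2_eq_square)
  then have "(1 + C_F * L)\<^sup>2 \<le> 1 + C_F\<^sup>2 * (2 * L + L\<^sup>2)"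
    by (simp add: power2_sum power_mult_distrib distrib_left mult_ac)
  also have "\<dots> \<le> 2 + C_F\<^sup>2 * (4 * l * l)"
  proof -
    have "2 * L + L\<^sup>2 \<le> 4 * l * l"
      using L_ge by (simp add: l power2_eq_square algebra_simps)
    then show ?thesis by (intro add_mono mult_left_mono) auto
  qed
  also have "\<dots> \<le> 2 + 4 * l * K"
    using mult_left_mono[OF K, of "4 * l"] L_ge by (simp add: l mult_ac)
  finally have "(1 + C_F * L)\<^sup>2 / g\<^sub>G \<le> (2 + 4 * l * K) / g\<^sub>G"
    using g\<^sub>G_pos by (intro divide_right_mono) auto
  then have 3: "(1 + C_F * L)\<^sup>2 / g\<^sub>G \<le> 2 / g\<^sub>G + P1"
    by (simp add: P1_def add_divide_distrib)
  show "2 * C_F + C_F\<^sup>2 * L + (1 + C_F * L)\<^sup>2 / g\<^sub>G \<le> inverse \<sigma>\<^sub>H"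
    unfolding inv using 1 2 3 \<mu> by linarith
  have "0 \<le> P1"
    using K0 g\<^sub>G_pos L_ge by (simp add: P1_def l)
  then show "2 / g\<^sub>G \<le> inverse \<sigma>\<^sub>H"
    unfolding inv using 1 \<mu> K0 by linarith
qed

lemma \<sigma>\<^sub>H_pos: "0 < \<sigma>\<^sub>H"
proof -
  have "0 < 2 / g\<^sub>G" using g\<^sub>G_pos by simp
  then show ?thesis using inverse_\<sigma>\<^sub>H(2) by (metis inverse_positive_iff_positive less_le_trans)
qed

text \<open>Strictness makes \<open>\<theta>\<close>, and hence the divisor \<open>rho_c\<close> in
  \<open>c_1\<close>, positive.\<close>

lemma \<sigma>\<^sub>H_less: "\<sigma>\<^sub>H < L_H L"
proof -
  have "g\<^sub>G * 1 \<le> g\<^sub>G * (2 * L^4 / (1 - \<alpha>)\<^sup>2 + 1)"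
    using g\<^sub>G_pos by (intro mult_left_mono) auto
  then have "g\<^sub>G \<le> 1"
    using g\<^sub>G_le \<gamma>_le by linarith
  then have "1 < 2 / g\<^sub>G"
    using g\<^sub>G_pos by simp
  then have "1 < inverse \<sigma>\<^sub>H"
    using inverse_\<sigma>\<^sub>H(2) by linarith
  then have "\<sigma>\<^sub>H < 1"
    using \<sigma>\<^sub>H_pos by (simp add: one_less_inverse_iff)
  then show ?thesis using L_ge by (simp add: L_H_def)
qed

lemma H_lower: "\<sigma>\<^sub>H * nrm v \<le> nrm (H v)"
proof -
  have "nrm v \<le> inverse \<sigma>\<^sub>H * nrm (H v)"
    using nrm_le_nrm_H[of v] mult_right_mono[OF inverse_\<sigma>\<^sub>H(1) nrm_ge_0[of "H v"]] by linarith
  then show ?thesis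
    using \<sigma>\<^sub>H_pos by (simp add: field_simps)
qed

sublocale KKT: banded_selfadjoint "Z \<times> {\<tau>..N}" "\<lambda>(z, t). take (Suc t) z" "\<lambda>(z, t). \<pi> z"
    H "\<lambda>p. length p - 1" "L_H L" \<sigma>\<^sub>H
proof
  show "\<bar>ip f (H f)\<bar> \<le> L_H L * ip f f" for f
    using H_upper by (simp add: L_H_def)
  show "H f p = 0" if "\<And>p. length p - 1 \<in> S \<Longrightarrow> f p = 0"
    "{length p - 1 - 1, length p - 1, length p - 1 + 1} \<subseteq> S" for S f p
    using that by (rule H_banded)
qed (rule H_linear H_selfadjoint \<sigma>\<^sub>H_pos \<sigma>\<^sub>H_less H_lower)+

lemma sqrt_\<theta>: "sqrt KKT.\<theta> = rho_c L \<alpha> \<gamma>"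
  unfolding KKT.\<theta>_def unfolding rho_c_def \<sigma>\<^sub>H_def ..

lemma KKT_solution:
  obtains v where
    "\<And>z t. \<lbrakk>z \<in> Z; t \<in> {\<tau>..N}\<rbrakk> \<Longrightarrow> H v (take (Suc t) z) = b (take (Suc t) z)"
    "\<And>t. KKT.lnrm t v \<le> c_1 L \<alpha> \<gamma> *
       (\<Sum>s\<in>{\<tau>..N}. rho_c L \<alpha> \<gamma> ^ (if t \<le> s then s - t else t - s) * KKT.lnrm s b)"
proof -
  have lev: "length (case j of (z, t) \<Rightarrow> take (Suc t) z) - 1 \<in> {\<tau>..N}"
    if "j \<in> Z \<times> {\<tau>..N}" for j
    using that by (auto simp: node_simps simp del: length_take)
  show ?thesis
  proof (rule KKT.solution_decay[OF finite_atLeastAtMost lev, of b])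
    fix v
    assume v: "\<And>j. j \<in> Z \<times> {\<tau>..N} \<Longrightarrow>
        H v (case j of (z, t) \<Rightarrow> take (Suc t) z) = b (case j of (z, t) \<Rightarrow> take (Suc t) z)"
      and decay: "\<And>t. KKT.lnrm t v \<le> L_H L / (\<sigma>\<^sub>H\<^sup>2 * sqrt KKT.\<theta>) *
        (\<Sum>s\<in>{\<tau>..N}. sqrt KKT.\<theta> ^ (if t \<le> s then s - t else t - s) * KKT.lnrm s b)"
    show ?thesis
    proof (rule that)
      show "H v (take (Suc t) z) = b (take (Suc t) z)" if "z \<in> Z" "t \<in> {\<tau>..N}" for z t
        using v[of "(z, t)"] that by simp
      show "KKT.lnrm t v \<le> c_1 L \<alpha> \<gamma> *
          (\<Sum>s\<in>{\<tau>..N}. rho_c L \<alpha> \<gamma> ^ (if t \<le> s then s - t else t - s) * KKT.lnrm s b)" for t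
        using decay[of t] unfolding sqrt_\<theta> unfolding c_1_def \<sigma>\<^sub>H_def .
    qed
  qed
qed

end

section \<open>Optimal policies\<close>

context lq_tree
begin

definition stage_nrm :: "nat \<Rightarrow> ('x list \<Rightarrow> 'e::real_inner) \<Rightarrow> real" where
  "stage_nrm t f = sqrt (\<Sum>z\<in>Z. \<pi> z * (norm (f (take (Suc t) z)))\<^sup>2)"

lemma stage_nrm_mono:
  assumes "\<And>z. z \<in> Z \<Longrightarrow> norm (f (take (Suc t) z)) \<le> norm (g (take (Suc t) z))"
  shows "stage_nrm t f \<le> stage_nrm t g"
  unfolding stage_nrm_def
  by (intro real_sqrt_le_mono sum_paths_mono power_mono assms) auto

text \<open>A path has exactly one prefix at each stage, so restricting to a level keeps one term
  per path.\<close>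

lemma lnrm_eq:
  assumes t: "t \<in> {\<tau>..N}"
  shows "KKT.lnrm t f = stage_nrm t f"
proof -
  let ?f = "\<lambda>p. if length p - 1 = t then f p else 0"
  have "ip ?f ?f = (\<Sum>t'=\<tau>..N. if t' = t then \<Sum>z\<in>Z. \<pi> z * (norm (f (take (Suc t') z)))\<^sup>2 else 0)"
    unfolding ip_stages
    by (intro sum.cong refl)
       (auto simp: node_simps power2_norm_eq_inner simp del: length_take intro!: sum.cong)
  then show ?thesis
    using t unfolding KKT.lnrm_def nrm_def stage_nrm_def by simp
qed

definition quad_cost :: "('x list \<Rightarrow> (real^'nx) \<times> (real^'nu)) \<Rightarrow> ('x list \<Rightarrow> (real^'nx) \<times> (real^'nu)) \<Rightarrow> real"
  where "quad_cost h w = ip w (G w) / 2 - ip w h"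

text \<open>The difference \<delta> of two feasible policies lies in the kernel of \<open>F\<close>,
  so the multiplier term and with it the first-order change of the cost vanish;
  \<open>ip \<delta> (G \<delta>) / 2\<close> remains. The explicit gap yields minimality and
  uniqueness at once.\<close>

lemma quad_cost_gap:
  assumes kkt: "\<And>z t. \<lbrakk>z \<in> Z; t \<in> {\<tau>..N}\<rbrakk> \<Longrightarrow> H v (take (Suc t) z) = (h (take (Suc t) z), c (take (Suc t) z))"
    and w': "\<And>z t. \<lbrakk>z \<in> Z; t \<in> {\<tau>..N}\<rbrakk> \<Longrightarrow> F w' (take (Suc t) z) = c (take (Suc t) z)"
  defines "w \<equiv> \<lambda>p. fst (v p)"
  shows "quad_cost h w + g\<^sub>G / 2 * (nrm (\<lambda>p. w' p - w p))\<^sup>2 \<le> quad_cost h w'"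
proof -
  define l where "l p = snd (v p)" for p
  define \<delta> where "\<delta> p = w' p - w p" for p
  have F\<delta>: "F \<delta> (take (Suc t) z) = 0" if "z \<in> Z" "\<tau> \<le> t" "t \<le> N" for z t
  proof -
    have "F \<delta> p = F w' p - F w p" for p
      by (simp add: F_def shift_op_def \<delta>_def matrix_vector_mult_diff_distrib)
    moreover have "F w (take (Suc t) z) = c (take (Suc t) z)"
      using kkt[of z t] that by (simp add: H_def w_def)
    ultimately show ?thesis
      using w'[of z t] that by simp
  qed
  have "ip \<delta> h = ip \<delta> (\<lambda>p. G w p + F_adj l p)"
    by (rule ip_cong) (use kkt in \<open>auto simp: H_def w_def l_def[abs_def]\<close>)
  also have "\<dots> = ip \<delta> (G w) + ip (F \<delta>) l"
    by (simp add: ip_add_right ip_F_adj)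
  also have "ip (F \<delta>) l = 0"
    using F\<delta> by (auto simp: ip_def intro!: sum.neutral)
  finally have \<delta>h: "ip \<delta> h = ip \<delta> (G w)" by simp
  have w'_eq: "w' = (\<lambda>p. w p + \<delta> p)" by (simp add: \<delta>_def)
  have G_add: "G w' = (\<lambda>p. G w p + G \<delta> p)"
    by (auto simp: G_def w'_eq matrix_vector_right_distrib)
  have "quad_cost h w' = quad_cost h w + ip \<delta> (G \<delta>) / 2"
    unfolding quad_cost_def G_add
    using ip_G_sym[of w \<delta>] ip_commute[of "G w" \<delta>] \<delta>h
    by (simp add: w'_eq ip_add_left ip_add_right field_simps)
  then show ?thesis
    using G_coercive[OF F\<delta>] by (simp add: nrm_power2 \<delta>_def[abs_def])
qed

lemma c_1_pos: "0 < c_1 L \<alpha> \<gamma>" and rho_c_pos: "0 < rho_c L \<alpha> \<gamma>"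
proof -
  show "0 < rho_c L \<alpha> \<gamma>"
    unfolding sqrt_\<theta>[symmetric] using KKT.\<theta>_bounds by simp
  then show "0 < c_1 L \<alpha> \<gamma>"
    using L_ge \<sigma>\<^sub>H_pos by (simp add: c_1_def L_H_def \<sigma>\<^sub>H_def)
qed

text \<open>\<open>F w = c\<close> encodes the dynamics: \<open>d\<close> enters at every stage, the
  previous decision \<open>wbar\<close> only at the root, where \<open>shift_op\<close> is
  0.\<close>

lemma optimal_policy:
  fixes d :: "'x \<Rightarrow> real^'nx" and q :: "'x \<Rightarrow> real^'nx" and r :: "'x \<Rightarrow> real^'nu"
    and wbar :: "(real^'nx) \<times> (real^'nu)"
  assumes prob: "sum \<pi> Z = 1"
    and h_def: "h = (\<lambda>p. (q (last p), r (last p)))"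
    and c_def: "c = (\<lambda>p. d (last p)
      + (if length p = Suc \<tau> then A (last p) *v fst wbar + B (last p) *v snd wbar else 0))"
  obtains w where
    "\<forall>z\<in>Z. \<forall>t\<in>{\<tau>..N}. F w (take (Suc t) z) = c (take (Suc t) z)"
    "\<forall>w'. (\<forall>z\<in>Z. \<forall>t\<in>{\<tau>..N}. F w' (take (Suc t) z) = c (take (Suc t) z)) \<longrightarrow>
       quad_cost h w + g\<^sub>G / 2 * (nrm (\<lambda>p. w' p - w p))\<^sup>2 \<le> quad_cost h w'"
    "\<forall>t\<in>{\<tau>..N}. stage_nrm t w \<le> c_1 L \<alpha> \<gamma> * (2 * L * rho_c L \<alpha> \<gamma> ^ (t - \<tau>) * norm wbar
       + (\<Sum>s\<in>{\<tau>..N}. rho_c L \<alpha> \<gamma> ^ (if t \<le> s then s - t else t - s)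
            * stage_nrm s (\<lambda>p. (q (last p), r (last p), d (last p)))))"
proof -
  define b where "b p = (h p, c p)" for p
  obtain v where v: "\<And>z t. \<lbrakk>z \<in> Z; t \<in> {\<tau>..N}\<rbrakk> \<Longrightarrow> H v (take (Suc t) z) = b (take (Suc t) z)"
    and decay: "\<And>t. KKT.lnrm t v \<le> c_1 L \<alpha> \<gamma> *
       (\<Sum>s\<in>{\<tau>..N}. rho_c L \<alpha> \<gamma> ^ (if t \<le> s then s - t else t - s) * KKT.lnrm s b)"
    by (rule KKT_solution[of b]) (rule that; blast)
  let ?\<rho> = "rho_c L \<alpha> \<gamma>"
  let ?p = "\<lambda>p. (q (last p), r (last p), d (last p))"
  \<comment> \<open>The contribution of \<open>wbar\<close> lives on stage \<open>\<tau>\<close>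
    alone, hence the single power of \<rho> in front of it. The 2 comes from bounding both
    components of \<open>wbar\<close> by its norm.\<close>
  have b_le: "KKT.lnrm s b \<le> stage_nrm s ?p + (if s = \<tau> then 2 * L * norm wbar else 0)"
    if s: "s \<in> {\<tau>..N}" for s
  proof -
    define b1 where "b1 p = (h p, d (last p))" for p
    define b2 :: "'x list \<Rightarrow> ((real^'nx) \<times> (real^'nu)) \<times> (real^'nx)" where
      "b2 p = (0, if length p = Suc \<tau> then A (last p) *v fst wbar + B (last p) *v snd wbar else 0)" for p
    have "b = (\<lambda>p. b1 p + b2 p)"
      by (simp add: b_def[abs_def] b1_def b2_def c_def)
    then have "KKT.lnrm s b \<le> stage_nrm s b1 + stage_nrm s b2"
      using KKT.lnrm_triangle[of s b1 b2] by (simp only: lnrm_eq[OF s])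
    moreover have "stage_nrm s b1 = stage_nrm s ?p"
      by (simp add: stage_nrm_def b1_def h_def norm_prod_def add.assoc)
    moreover have "stage_nrm s b2 \<le> (if s = \<tau> then 2 * L * norm wbar else 0)"
    proof (cases "s = \<tau>")
      case True
      have pt: "(norm (b2 (take (Suc s) z)))\<^sup>2 \<le> (2 * L * norm wbar)\<^sup>2" if z: "z \<in> Z" for z
      proof (rule power_mono)
        have "norm (A (z ! s) *v fst wbar + B (z ! s) *v snd wbar) \<le> L * norm (fst wbar) + L * norm (snd wbar)"
          using bounds[OF z, of s] s by (intro norm_triangle_mono norm_mult_vec_le) auto
        also have "\<dots> \<le> L * norm wbar + L * norm wbar"
          using L_ge norm_fst_le[of "fst wbar" "snd wbar"] norm_snd_le[of "snd wbar" "fst wbar"]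
          by (intro add_mono mult_left_mono) auto
        finally show "norm (b2 (take (Suc s) z)) \<le> 2 * L * norm wbar"
          using s z True by (simp add: b2_def node_simps del: length_take)
      qed simp
      have "stage_nrm s b2 \<le> sqrt (\<Sum>z\<in>Z. \<pi> z * (2 * L * norm wbar)\<^sup>2)"
        unfolding stage_nrm_def by (intro real_sqrt_le_mono sum_paths_mono pt)
      also have "\<dots> = 2 * L * norm wbar"
        using L_ge prob by (simp add: sum_distrib_right[symmetric])
      finally show ?thesis using True by simp
    next
      case False
      then have "b2 (take (Suc s) z) = 0" if "z \<in> Z" for z
        using s that by (simp add: b2_def node_simps zero_prod_def del: length_take)
      then show ?thesis
        using False by (simp add: stage_nrm_def)
    qed
    ultimately show ?thesis by linarith
  qed
  show ?thesis
  proof (rule that[of "\<lambda>p. fst (v p)"], safe)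
    show "F (\<lambda>p. fst (v p)) (take (Suc t) z) = c (take (Suc t) z)" if "z \<in> Z" "t \<in> {\<tau>..N}" for z t
      using v[OF that] by (simp add: H_def b_def)
    show "quad_cost h (\<lambda>p. fst (v p)) + g\<^sub>G / 2 * (nrm (\<lambda>p. w' p - fst (v p)))\<^sup>2 \<le> quad_cost h w'"
      if "\<forall>z\<in>Z. \<forall>t\<in>{\<tau>..N}. F w' (take (Suc t) z) = c (take (Suc t) z)" for w'
      by (rule quad_cost_gap[of v h c w']) (use v that in \<open>auto simp: b_def\<close>)
    show "stage_nrm t (\<lambda>p. fst (v p)) \<le> c_1 L \<alpha> \<gamma> * (2 * L * ?\<rho> ^ (t - \<tau>) * norm wbar
       + (\<Sum>s\<in>{\<tau>..N}. ?\<rho> ^ (if t \<le> s then s - t else t - s) * stage_nrm s ?p))"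
      if t: "t \<in> {\<tau>..N}" for t
    proof -
      let ?D = "\<lambda>s. if t \<le> s then s - t else t - s"
      have "stage_nrm t (\<lambda>p. fst (v p)) \<le> stage_nrm t v"
        by (rule stage_nrm_mono) (metis norm_fst_le prod.collapse)
      also have "\<dots> \<le> c_1 L \<alpha> \<gamma> * (\<Sum>s\<in>{\<tau>..N}. ?\<rho> ^ ?D s * KKT.lnrm s b)"
        using decay[of t] unfolding lnrm_eq[OF t] .
      also have "(\<Sum>s\<in>{\<tau>..N}. ?\<rho> ^ ?D s * KKT.lnrm s b)
          \<le> (\<Sum>s\<in>{\<tau>..N}. ?\<rho> ^ ?D s * (stage_nrm s ?p + (if s = \<tau> then 2 * L * norm wbar else 0)))"
        using rho_c_pos by (intro sum_mono mult_left_mono b_le) auto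
      also have "\<dots> = (\<Sum>s\<in>{\<tau>..N}. ?\<rho> ^ ?D s * stage_nrm s ?p)
          + (\<Sum>s\<in>{\<tau>..N}. if s = \<tau> then ?\<rho> ^ ?D s * (2 * L * norm wbar) else 0)"
        unfolding sum.distrib[symmetric] by (intro sum.cong refl) (simp add: distrib_left)
      also have "(\<Sum>s\<in>{\<tau>..N}. if s = \<tau> then ?\<rho> ^ ?D s * (2 * L * norm wbar) else 0)
          = 2 * L * ?\<rho> ^ (t - \<tau>) * norm wbar"
        using t \<tau>_le by simp
      finally show ?thesis
        using c_1_pos by (simp add: add.commute)
    qed
  qed
qed

end

theorem theorem1:
  fixes P :: "'x list pmf" and T :: nat
    and A :: "'x \<Rightarrow> real^'nx::finite^'nx" and B :: "'x \<Rightarrow> real^'nu::finite^'nx"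
    and d :: "'x \<Rightarrow> real^'nx" and Q :: "'x \<Rightarrow> real^'nx^'nx" and R :: "'x \<Rightarrow> real^'nu^'nu"
    and q :: "'x \<Rightarrow> real^'nx" and r :: "'x \<Rightarrow> real^'nu"
    and L \<alpha> \<gamma> :: real
    and \<xi>0 :: 'x and \<tau> W :: nat and wbar :: "(real^'nx) \<times> (real^'nu)"
  assumes T_pos: "0 < T"
    and paths: "\<forall>z\<in>set_pmf P. length z = Suc T"
    and Q_sym: "\<forall>x. transpose (Q x) = Q x"
    and R_sym: "\<forall>x. transpose (R x) = R x"
    \<comment> \<open>Assumption 1\<close>
    and finite_support: "finite (set_pmf P)"
    \<comment> \<open>Assumption 2\<close>
    and L_ge: "1 \<le> L" and \<alpha>_pos: "0 < \<alpha>" and \<alpha>_lt: "\<alpha> < 1"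
    and \<gamma>_pos: "0 < \<gamma>" and \<gamma>_le: "\<gamma> \<le> 1"
    and bounds: "\<forall>z\<in>set_pmf P. \<forall>t\<le>T. spec_norm (A (z ! t)) \<le> L \<and> spec_norm (B (z ! t)) \<le> L
                   \<and> spec_norm (Q (z ! t)) \<le> L \<and> spec_norm (R (z ! t)) \<le> L"
    and Q_psd: "\<forall>z\<in>set_pmf P. \<forall>t\<le>T. \<forall>v. 0 \<le> v \<bullet> (Q (z ! t) *v v)"
    and R_pd: "\<forall>z\<in>set_pmf P. \<forall>t\<le>T. \<forall>v. \<gamma> * (v \<bullet> v) \<le> v \<bullet> (R (z ! t) *v v)"
    and stabilizable: "stoch_stabilizable P T L \<alpha> A B"
    and detectable: "stoch_detectable P T L \<alpha> A (\<lambda>x. msqrt (Q x))"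
    \<comment> \<open>data of the statement\<close>
    and \<xi>0_in: "\<xi>0 \<in> (\<lambda>z. z ! 0) ` set_pmf P"
    and \<tau>_le: "\<tau> \<le> T"
  shows "\<forall>s\<in>{take (Suc \<tau>) z |z. z \<in> set_pmf P \<and> z ! 0 = \<xi>0}.
     \<exists>w. trunc_solution P T A B d Q R q r \<tau> W s wbar w
       \<and> (\<forall>w'. trunc_solution P T A B d Q R q r \<tau> W s wbar w' \<longrightarrow> policies_agree P T \<tau> W s w w')
       \<and> (\<forall>t\<in>{\<tau>..min (\<tau> + W) T}.
            sqrt (cond_exp P \<tau> s (\<lambda>z. (norm (w t (take (Suc t) z)))^2))
            \<le> c_1 L \<alpha> \<gamma> * (2 * L * (rho_c L \<alpha> \<gamma>) ^ (t - \<tau>) * norm wbar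
                 + (\<Sum>t'\<in>{\<tau>..min (\<tau> + W) T}.
                      (rho_c L \<alpha> \<gamma>) ^ (if t \<le> t' then t' - t else t - t')
                      * sqrt (cond_exp P \<tau> s (\<lambda>z. (norm (q (z ! t'), r (z ! t'), d (z ! t')))^2)))))"
proof
  fix s assume "s \<in> {take (Suc \<tau>) z |z. z \<in> set_pmf P \<and> z ! 0 = \<xi>0}"
  then obtain z0 where z0: "z0 \<in> set_pmf P" "s = take (Suc \<tau>) z0" by blast
  obtain Ks where Ks: "\<And>z t. \<lbrakk>z \<in> set_pmf P; t < T\<rbrakk> \<Longrightarrow> spec_norm (Ks t (take (Suc t) z)) \<le> L"
    "stoch_stable P T L \<alpha> (\<lambda>t zs. A (zs ! t) - B (zs ! t) ** Ks (t - 1) (take t zs))"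
    using stabilizable unfolding stoch_stabilizable_def by blast
  obtain Kd :: "nat \<Rightarrow> 'x list \<Rightarrow> real^'nx^'nx" where
    Kd: "\<And>z t. \<lbrakk>z \<in> set_pmf P; 1 \<le> t; t \<le> T\<rbrakk> \<Longrightarrow> spec_norm (Kd t (take (Suc t) z)) \<le> L"
    "stoch_stable P T L \<alpha> (\<lambda>t zs. A (zs ! t) - Kd t zs ** msqrt (Q (zs ! (t - 1))))"
    using detectable unfolding stoch_detectable_def by blast
  define N where "N = min (\<tau> + W) T"
  have N: "\<tau> \<le> N" "N \<le> T" using \<tau>_le by (auto simp: N_def)
  define Z where "Z = set_pmf P \<inter> prefix_event \<tau> s"
  define \<pi> where "\<pi> = pmf (cond_pmf P (prefix_event \<tau> s))"
  have ZP: "z \<in> set_pmf P" and Zs: "take (Suc \<tau>) z = s" and Zlen: "length z = Suc T" if "z \<in> Z" for z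
    using that paths by (auto simp: Z_def prefix_event_def)
  have "set_pmf P \<inter> prefix_event \<tau> s \<noteq> {}"
    using z0 by (auto simp: prefix_event_def)
  then have set_cond: "set_pmf (cond_pmf P (prefix_event \<tau> s)) = Z"
    unfolding Z_def by (rule set_cond_pmf)
  have finZ: "finite Z" using finite_support by (simp add: Z_def)
  have E: "cond_exp P \<tau> s g = (\<Sum>z\<in>Z. \<pi> z * g z)" for g
    unfolding cond_exp_def \<pi>_def
    by (subst integral_measure_pmf_real[OF finZ]) (auto simp: set_cond mult.commute)
  have prob: "sum \<pi> Z = 1"
    unfolding \<pi>_def by (rule sum_pmf_eq_1) (simp_all add: finZ set_cond)
  interpret lq_tree Z \<pi> \<tau> N A B Q R L \<alpha> \<gamma> Ks Kd
  proof
    show "0 < \<pi> z" if "z \<in> Z" for z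
      using that by (simp add: \<pi>_def pmf_positive_iff set_cond)
    show "spec_norm (mprod (\<lambda>s. A (z ! s) - B (z ! s) ** Ks (s - 1) (take s z)) t' t'') \<le> L * \<alpha> ^ (t'' - t')"
      if "z \<in> Z" "t' < t''" "t'' \<le> N" for z t' t''
    proof -
      \<comment> \<open>\<open>stoch_stable\<close> evaluates at the prefix ending with stage
        \<open>s\<close>; entry \<open>s\<close> and shorter prefixes are the same there as in
        \<open>z\<close>.\<close>
      have "spec_norm (mprod (\<lambda>s. A (take (Suc s) z ! s) - B (take (Suc s) z ! s)
          ** Ks (s - 1) (take s (take (Suc s) z))) t' t'') \<le> L * \<alpha> ^ (t'' - t')"
        using Ks(2) ZP[OF that(1)] that N unfolding stoch_stable_def by simp
      then show ?thesis by (simp add: min_def)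
    qed
    show "spec_norm (mprod (\<lambda>s. A (z ! s) - Kd s (take (Suc s) z) ** msqrt (Q (z ! (s - 1)))) t' t'')
        \<le> L * \<alpha> ^ (t'' - t')"
      if "z \<in> Z" "t' < t''" "t'' \<le> N" for z t' t''
    proof -
      have "spec_norm (mprod (\<lambda>s. A (take (Suc s) z ! s) - Kd s (take (Suc s) z)
          ** msqrt (Q (take (Suc s) z ! (s - 1)))) t' t'') \<le> L * \<alpha> ^ (t'' - t')"
        using Kd(2) ZP[OF that(1)] that N unfolding stoch_stable_def by simp
      then show ?thesis by simp
    qed
  qed (use finZ Zlen N ZP L_ge \<alpha>_pos \<alpha>_lt \<gamma>_pos \<gamma>_le Q_sym R_sym bounds Q_psd R_pd Ks(1) Kd(1) in auto)

  define h where "h = (\<lambda>p. (q (last p), r (last p)))"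
  define c where "c = (\<lambda>p. d (last p)
      + (if length p = Suc \<tau> then A (last p) *v fst wbar + B (last p) *v snd wbar else 0))"
  \<comment> \<open>Policies are indexed by stage, whereas the operators act on one function of
    prefixes; the length of a prefix determines its stage.\<close>
  define node :: "(nat \<Rightarrow> 'x list \<Rightarrow> (real^'nx) \<times> (real^'nu)) \<Rightarrow> 'x list \<Rightarrow> (real^'nx) \<times> (real^'nu)" where
    "node w p = w (length p - 1) p" for w p
  have node_eq: "node w (take (Suc t) z) = w t (take (Suc t) z)" if "z \<in> Z" "t \<le> N" for w z t
    using that by (simp add: node_def node_simps del: length_take)
  have feasible_iff: "trunc_feasible P T A B d \<tau> W s wbar w
      \<longleftrightarrow> (\<forall>z\<in>Z. \<forall>t\<in>{\<tau>..N}. F (node w) (take (Suc t) z) = c (take (Suc t) z))" for w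
  proof -
    have root: "F (node w) (take (Suc \<tau>) z) = c (take (Suc \<tau>) z)
        \<longleftrightarrow> fst (w \<tau> s) = dyn A B d wbar (s ! \<tau>)" if z: "z \<in> Z" for z
    proof -
      have "s ! \<tau> = z ! \<tau>" "length s = Suc \<tau>" "last s = z ! \<tau>"
        using Zs[OF z] node_simps(1,2)[OF z N(1)] by auto
      then show ?thesis
        unfolding F_node[OF z N(1)] node_eq[OF z N(1)]
        by (auto simp: Zs[OF z] c_def dyn_def algebra_simps)
    qed
    have later: "F (node w) (take (Suc t) z) = c (take (Suc t) z)
        \<longleftrightarrow> fst (w t (take (Suc t) z)) = dyn A B d (w (t - 1) (take t z)) (z ! t)"
      if z: "z \<in> Z" and t: "\<tau> < t" "t \<le> N" for z t
    proof -
      obtain k where k: "t = Suc k" "k \<le> N" using t by (cases t) auto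
      show ?thesis
        unfolding F_node[OF z t(2)] node_eq[OF z t(2)]
        using z t k node_eq[OF z k(2), of w]
        by (auto simp: c_def dyn_def node_simps algebra_simps simp del: length_take)
    qed
    \<comment> \<open>The root equation mentions only \<open>s\<close>; recovering it from equations
      quantified over \<open>Z\<close> takes a path in \<open>Z\<close>.\<close>
    have "z0 \<in> Z" using z0 by (simp add: Z_def prefix_event_def)
    have "(\<forall>z\<in>Z. \<forall>t\<in>{\<tau>..N}. F (node w) (take (Suc t) z) = c (take (Suc t) z))
        \<longleftrightarrow> (\<forall>z\<in>Z. F (node w) (take (Suc \<tau>) z) = c (take (Suc \<tau>) z)
          \<and> (\<forall>t. \<tau> < t \<and> t \<le> N \<longrightarrow> F (node w) (take (Suc t) z) = c (take (Suc t) z)))"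
      using N(1) by (force simp: le_less)
    also have "\<dots> \<longleftrightarrow> (\<forall>z\<in>Z. fst (w \<tau> s) = dyn A B d wbar (s ! \<tau>)
          \<and> (\<forall>t. \<tau> < t \<and> t \<le> N \<longrightarrow>
            fst (w t (take (Suc t) z)) = dyn A B d (w (t - 1) (take t z)) (z ! t)))"
      by (simp only: root later cong: ball_cong imp_cong conj_cong)
    finally show ?thesis
      unfolding trunc_feasible_def Z_def[symmetric] N_def[symmetric]
      using \<open>z0 \<in> Z\<close> by blast
  qed
  have cost_eq: "trunc_cost P T Q R q r \<tau> W s w = quad_cost h (node w)" for w
  proof -
    have "trunc_cost P T Q R q r \<tau> W s w
        = (\<Sum>z\<in>Z. \<pi> z * (\<Sum>t=\<tau>..N. stage_cost Q R q r (w t (take (Suc t) z)) (z ! t)))"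
      by (simp add: trunc_cost_def E N_def)
    also have "\<dots> = (\<Sum>z\<in>Z. \<pi> z * (\<Sum>t=\<tau>..N. node w (take (Suc t) z) \<bullet> G (node w) (take (Suc t) z) / 2
        - node w (take (Suc t) z) \<bullet> h (take (Suc t) z)))"
      by (intro sum.cong refl arg_cong2[where f = "(*)"])
         (auto simp: stage_cost_def node_eq G_def h_def node_simps inner_prod_def inner_commute[of "q _"]
            inner_commute[of "r _"] add_divide_distrib simp del: length_take)
    also have "\<dots> = quad_cost h (node w)"
      by (simp add: quad_cost_def ip_paths sum_subtractf right_diff_distrib sum_divide_distrib
          sum_distrib_left)
    finally show ?thesis .
  qed
  obtain w where w: "\<forall>z\<in>Z. \<forall>t\<in>{\<tau>..N}. F w (take (Suc t) z) = c (take (Suc t) z)"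
    and gap: "\<forall>w'. (\<forall>z\<in>Z. \<forall>t\<in>{\<tau>..N}. F w' (take (Suc t) z) = c (take (Suc t) z)) \<longrightarrow>
       quad_cost h w + g\<^sub>G / 2 * (nrm (\<lambda>p. w' p - w p))\<^sup>2 \<le> quad_cost h w'"
    and decay: "\<forall>t\<in>{\<tau>..N}. stage_nrm t w \<le> c_1 L \<alpha> \<gamma> * (2 * L * rho_c L \<alpha> \<gamma> ^ (t - \<tau>) * norm wbar
       + (\<Sum>s\<in>{\<tau>..N}. rho_c L \<alpha> \<gamma> ^ (if t \<le> s then s - t else t - s)
            * stage_nrm s (\<lambda>p. (q (last p), r (last p), d (last p)))))"
    by (rule optimal_policy[OF prob h_def c_def])
  \<comment> \<open>A function of prefixes is already a policy: prefixes of different stages differ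
    in length, so the stage index carries no further information.\<close>
  let ?w = "\<lambda>t. w"
  have node_w: "node ?w = w" by (simp add: node_def[abs_def])
  have sol: "trunc_solution P T A B d Q R q r \<tau> W s wbar ?w"
    unfolding trunc_solution_def
  proof (intro conjI allI impI)
    show "trunc_feasible P T A B d \<tau> W s wbar ?w"
      unfolding feasible_iff node_w using w by blast
    fix w' assume "trunc_feasible P T A B d \<tau> W s wbar w'"
    then have "quad_cost h w + g\<^sub>G / 2 * (nrm (\<lambda>p. node w' p - w p))\<^sup>2 \<le> quad_cost h (node w')"
      unfolding feasible_iff using gap by blast
    moreover have "0 \<le> g\<^sub>G / 2 * (nrm (\<lambda>p. node w' p - w p))\<^sup>2"
      using g\<^sub>G_pos by simp
    ultimately show "trunc_cost P T Q R q r \<tau> W s ?w \<le> trunc_cost P T Q R q r \<tau> W s w'"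
      unfolding cost_eq node_w by linarith
  qed
  \<comment> \<open>At a second minimizer the gap inequality forces seminorm 0 of the difference,
    that is, agreement at every node, as \<open>policies_agree\<close> demands.\<close>
  have uniq: "policies_agree P T \<tau> W s ?w w'" if w': "trunc_solution P T A B d Q R q r \<tau> W s wbar w'" for w'
  proof -
    have "quad_cost h w + g\<^sub>G / 2 * (nrm (\<lambda>p. node w' p - w p))\<^sup>2 \<le> quad_cost h (node w')"
      using w' gap unfolding trunc_solution_def feasible_iff by blast
    moreover have "quad_cost h (node w') \<le> quad_cost h w"
      using w' sol unfolding trunc_solution_def cost_eq by (metis node_w)
    ultimately have "g\<^sub>G / 2 * (nrm (\<lambda>p. node w' p - w p))\<^sup>2 \<le> 0"
      by linarith
    then have "nrm (\<lambda>p. node w' p - w p) = 0"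
      using g\<^sub>G_pos by (simp add: mult_le_0_iff)
    then have "node w' (take (Suc t) z) = w (take (Suc t) z)" if "z \<in> Z" "t \<in> {\<tau>..N}" for z t
      using that unfolding nrm_eq_0_iff by force
    then show ?thesis
      unfolding policies_agree_def Z_def[symmetric] N_def[symmetric] by (auto simp: node_eq)
  qed
  have p_eq: "stage_nrm t (\<lambda>p. (q (last p), r (last p), d (last p)))
      = sqrt (cond_exp P \<tau> s (\<lambda>z. (norm (q (z ! t), r (z ! t), d (z ! t)))\<^sup>2))" if "t \<in> {\<tau>..N}" for t
    using that by (simp add: stage_nrm_def E node_simps)
  show "\<exists>w. trunc_solution P T A B d Q R q r \<tau> W s wbar w
       \<and> (\<forall>w'. trunc_solution P T A B d Q R q r \<tau> W s wbar w' \<longrightarrow> policies_agree P T \<tau> W s w w')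
       \<and> (\<forall>t\<in>{\<tau>..min (\<tau> + W) T}.
            sqrt (cond_exp P \<tau> s (\<lambda>z. (norm (w t (take (Suc t) z)))^2))
            \<le> c_1 L \<alpha> \<gamma> * (2 * L * (rho_c L \<alpha> \<gamma>) ^ (t - \<tau>) * norm wbar
                 + (\<Sum>t'\<in>{\<tau>..min (\<tau> + W) T}.
                      (rho_c L \<alpha> \<gamma>) ^ (if t \<le> t' then t' - t else t - t')
                      * sqrt (cond_exp P \<tau> s (\<lambda>z. (norm (q (z ! t'), r (z ! t'), d (z ! t')))^2)))))"
    unfolding N_def[symmetric]
  proof (intro exI[of _ ?w] conjI allI impI ballI sol uniq)
    fix t assume t: "t \<in> {\<tau>..N}"
    have "sqrt (cond_exp P \<tau> s (\<lambda>z. (norm (w (take (Suc t) z)))^2)) = stage_nrm t w"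
      by (simp add: stage_nrm_def E)
    also have "\<dots> \<le> c_1 L \<alpha> \<gamma> * (2 * L * rho_c L \<alpha> \<gamma> ^ (t - \<tau>) * norm wbar
       + (\<Sum>s\<in>{\<tau>..N}. rho_c L \<alpha> \<gamma> ^ (if t \<le> s then s - t else t - s)
            * stage_nrm s (\<lambda>p. (q (last p), r (last p), d (last p)))))"
      using decay t by blast
    also have "(\<Sum>s\<in>{\<tau>..N}. rho_c L \<alpha> \<gamma> ^ (if t \<le> s then s - t else t - s)
            * stage_nrm s (\<lambda>p. (q (last p), r (last p), d (last p))))
        = (\<Sum>t'\<in>{\<tau>..N}. rho_c L \<alpha> \<gamma> ^ (if t \<le> t' then t' - t else t - t')
            * sqrt (cond_exp P \<tau> s (\<lambda>z. (norm (q (z ! t'), r (z ! t'), d (z ! t')))^2)))"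
      by (intro sum.cong refl arg_cong2[where f = "(*)"] p_eq)
    finally show "sqrt (cond_exp P \<tau> s (\<lambda>z. (norm (w (take (Suc t) z)))^2))
        \<le> c_1 L \<alpha> \<gamma> * (2 * L * rho_c L \<alpha> \<gamma> ^ (t - \<tau>) * norm wbar
           + (\<Sum>t'\<in>{\<tau>..N}. rho_c L \<alpha> \<gamma> ^ (if t \<le> t' then t' - t else t - t')
            * sqrt (cond_exp P \<tau> s (\<lambda>z. (norm (q (z ! t'), r (z ! t'), d (z ! t')))^2))))" .
  qed
qed

end
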